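(* Let $G$ be a finite group that is a split extension over a nilpotent normal subgroup $N$ (i.e. $N$ has a complement in $G$) such that $G/N$ is nilpotent. Suppose that for each prime $p$ there is a Sylow $p$-subgroup $S$ of $G$ such that any two complements of $S \cap N$ in $S$ are conjugate in $G$. Then any two complements of $N$ in $G$ are conjugate in $G$.
   Context: A complement of a normal subgroup $M$ in a group $X$ is a subgroup $K \leq X$ with $MK = X$ and $M \cap K = 1$. *)

theory Defs
  imports "HOL-Algebra.Algebra"
begin

definition commutator_subgroup :: "('a, 'b) monoid_scheme \<Rightarrow> 'a set \<Rightarrow> 'a set \<Rightarrow> 'a set" where
  "commutator_subgroup G H K =
     generate G (\<Union>h\<in>H. \<Union>k\<in>K. {h \<otimes>\<^bsub>G\<^esub> k \<otimes>\<^bsub>G\<^esub> inv\<^bsub>G\<^esub> h \<otimes>\<^bsub>G\<^esub> inv\<^bsub>G\<^esub> k})"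

text \<open>The indexing starts at 0, so that the group is nilpotent of class at most \<open>n\<close>
  iff the \<open>n\<close>-th term is trivial.\<close>

primrec lower_central_series :: "('a, 'b) monoid_scheme \<Rightarrow> nat \<Rightarrow> 'a set" where
  "lower_central_series G 0 = carrier G"
| "lower_central_series G (Suc n) = commutator_subgroup G (lower_central_series G n) (carrier G)"

definition nilpotent_group :: "('a, 'b) monoid_scheme \<Rightarrow> bool" where
  "nilpotent_group G \<longleftrightarrow> group G \<and> (\<exists>n. lower_central_series G n = {\<one>\<^bsub>G\<^esub>})"

text \<open>Only meant to be used for \<open>M \<lhd> G\<close>.\<close>

definition is_complement :: "('a, 'b) monoid_scheme \<Rightarrow> 'a set \<Rightarrow> 'a set \<Rightarrow> bool" where
  "is_complement G M K \<longleftrightarrow> subgroup K G \<and> M <#>\<^bsub>G\<^esub> K = carrier G \<and> M \<inter> K = {\<one>\<^bsub>G\<^esub>}"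

text \<open>Only meant to be used for finite \<open>G\<close> and prime \<open>p\<close>. If \<open>p\<close> does not divide the order
  of \<open>G\<close>, the only Sylow \<open>p\<close>-subgroup is the trivial one.\<close>

definition sylow_subgroup :: "nat \<Rightarrow> ('a, 'b) monoid_scheme \<Rightarrow> 'a set \<Rightarrow> bool" where
  "sylow_subgroup p G S \<longleftrightarrow> subgroup S G \<and> card S = p ^ multiplicity p (order G)"

definition conjugate_in :: "('a, 'b) monoid_scheme \<Rightarrow> 'a set \<Rightarrow> 'a set \<Rightarrow> bool" where
  "conjugate_in G H K \<longleftrightarrow> (\<exists>g\<in>carrier G. K = g <#\<^bsub>G\<^esub> H #>\<^bsub>G\<^esub> inv\<^bsub>G\<^esub> g)"

end

theory Submission
  imports Defs
begin

text \<open>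
  Let \<open>K\<close> and \<open>L\<close> be complements of \<open>N\<close> in \<open>G\<close>. In cohomological terms the classes of complements
  form the pointed set \<open>H\<^sup>1(K, N)\<close>. Since \<open>N\<close> is the direct product of its Sylow subgroups \<open>N\<^sub>p\<close>,
  this set is the product of the sets \<open>H\<^sup>1(K, N\<^sub>p)\<close>; since \<open>K\<close> is nilpotent, the class in
  \<open>H\<^sup>1(K, N\<^sub>p)\<close> is determined by its restriction to the Sylow \<open>p\<close>-subgroup \<open>K\<^sub>p\<close> of \<open>K\<close>; and that
  restriction is trivial by the hypothesis on the Sylow subgroup \<open>N\<^sub>p K\<^sub>p\<close> of \<open>G\<close>. The proof carries
  this out with subgroups and elements.

  Fix a prime \<open>p\<close> and write \<open>N = N\<^sub>p \<times> A\<close>, with \<open>A\<close> the product of the other Sylow subgroups of \<open>N\<close>.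
  The group \<open>L\<^sub>0 = A L \<inter> N\<^sub>p K\<close> is a complement of \<open>N\<^sub>p\<close> in \<open>N\<^sub>p K\<close>
  (\<open>complement_component\<close>). By hypothesis, \<open>K\<^sub>p\<close> and the intersection of \<open>L\<^sub>0\<close> with \<open>N\<^sub>p K\<^sub>p\<close> are
  conjugate in \<open>G\<close>, and the conjugating element can be taken in \<open>N\<^sub>p\<close>
  (\<open>sylow_parts_conjugate\<close>). The Sylow subgroups of \<open>K\<close> for the other primes \<open>q\<close> have order prime to
  that of \<open>N\<^sub>p\<close>, so they can be moved into \<open>L\<^sub>0\<close> by Sylow's theorem; doing this inside the
  centralizer of the Sylow subgroups moved before keeps the latter in place
  (\<open>p_kernel_complements_conjugate\<close>). Thus some element of \<open>N\<^sub>p\<close> conjugates \<open>K\<close> into \<open>A L\<close>.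

  Applying this to one prime after another gives an element of \<open>N\<close> that conjugates \<open>K\<close> into \<open>A L\<close>
  for all these groups \<open>A\<close> simultaneously. Their intersection is trivial, so the conjugate of \<open>K\<close> lies
  in \<open>L\<close>, and it equals \<open>L\<close> by comparing orders.
\<close>

section \<open>Conjugation and cardinalities\<close>

lemma (in group) inv_cancel_left:
  assumes "x \<in> carrier G" "y \<in> carrier G"
  shows "inv x \<otimes> (x \<otimes> y) = y" and "x \<otimes> (inv x \<otimes> y) = y"
  using assms by (simp_all add: m_assoc [symmetric])

text \<open>
  As rewrite rules these bring a word in group elements and their inverses into freely reduced
  form, so that \<open>simp\<close> decides the identities that hold in all groups.
\<close>

lemmas (in group) word_simps = m_assoc inv_mult_group inv_cancel_left

lemma (in group) conjugate_eq_image: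
  assumes "H \<subseteq> carrier G" "g \<in> carrier G"
  shows "(g <# H) #> inv g = (\<lambda>x. g \<otimes> x \<otimes> inv g) ` H"
  by (auto simp: l_coset_def r_coset_def)

lemma (in group) subgroup_conjugate_image:
  assumes "subgroup H G" "g \<in> carrier G"
  shows "subgroup ((\<lambda>x. g \<otimes> x \<otimes> inv g) ` H) G"
  using subgroup_conjugation_is_surj2[OF assms(2,1)] conjugate_eq_image[OF subgroup.subset[OF assms(1)] assms(2)]
  by simp

lemma (in group) mem_inv_conjugate_image_iff:
  assumes "H \<subseteq> carrier G" "g \<in> carrier G" "y \<in> carrier G"
  shows "y \<in> (\<lambda>x. inv g \<otimes> x \<otimes> inv (inv g)) ` H \<longleftrightarrow> g \<otimes> y \<otimes> inv g \<in> H"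
proof
  assume "y \<in> (\<lambda>x. inv g \<otimes> x \<otimes> inv (inv g)) ` H"
  then obtain x where x: "x \<in> H" "y = inv g \<otimes> x \<otimes> inv (inv g)" by auto
  then have "g \<otimes> y \<otimes> inv g = x" using assms by (simp add: word_simps subset_iff)
  then show "g \<otimes> y \<otimes> inv g \<in> H" using x by simp
next
  assume "g \<otimes> y \<otimes> inv g \<in> H"
  moreover have "y = inv g \<otimes> (g \<otimes> y \<otimes> inv g) \<otimes> inv (inv g)"
    using assms by (simp add: word_simps)
  ultimately show "y \<in> (\<lambda>x. inv g \<otimes> x \<otimes> inv (inv g)) ` H" by (rule rev_image_eqI)
qed

lemma (in group) card_conjugate_image:
  assumes "H \<subseteq> carrier G" "g \<in> carrier G"
  shows "card ((\<lambda>x. g \<otimes> x \<otimes> inv g) ` H) = card H"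
proof (rule card_image, rule inj_onI)
  fix x y assume "x \<in> H" "y \<in> H" "g \<otimes> x \<otimes> inv g = g \<otimes> y \<otimes> inv g"
  then show "x = y" using assms by (meson conjugation_is_inj subsetD)
qed

lemma (in group) card_subgroup_dvd:
  assumes "subgroup H G" "subgroup K G" "H \<subseteq> K" "finite K"
  shows "card H dvd card K"
proof -
  interpret K: group "G\<lparr>carrier := K\<rparr>" using assms by (simp add: subgroup_imp_group)
  have "subgroup H (G\<lparr>carrier := K\<rparr>)" using assms by (simp add: subgroup_incl)
  from K.lagrange[OF this]
  have "card K = card (rcosets\<^bsub>G\<lparr>carrier := K\<rparr>\<^esub> H) * card H" by (simp add: order_def)
  then show ?thesis by simp
qed

section \<open>Fixed points and Sylow conjugation\<close>

text \<open>
  The length of an orbit divides \<open>q ^ a\<close>, so an orbit with more than one point has length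
  divisible by \<open>q\<close>. If there were no orbit of length one, \<open>q\<close> would divide the cardinality
  of \<open>E\<close>.
\<close>

lemma (in group_action) p_group_fixed_point:
  assumes "Factorial_Ring.prime q" "order G = q ^ a" "finite E" "\<not> q dvd card E"
  shows "\<exists>x\<in>E. \<forall>g\<in>carrier G. \<phi> g x = x"
proof (rule ccontr)
  assume no_fix: "\<not> ?thesis"
  have "q dvd card orb" if orb: "orb \<in> orbits G E \<phi>" for orb
  proof -
    obtain x where x: "x \<in> E" "orb = orbit G \<phi> x" using orb unfolding orbits_def by blast
    have "card orb dvd q ^ a"
      using orbit_stabilizer_theorem[OF x(1)] x(2) assms(2) by (metis dvd_triv_left)
    then obtain b where b: "card orb = q ^ b"
      using assms(1) divides_primepow_nat by blast
    have "b \<noteq> 0"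
    proof
      assume "b = 0"
      then have "card orb = 1" using b by simp
      then have "orb = {x}" using orbit_refl[OF x(1)] x(2) by (metis card_1_singletonE singletonD)
      then have "\<forall>g\<in>carrier G. \<phi> g x = x" using x(2) by (auto simp: orbit_def)
      then show False using no_fix x(1) by blast
    qed
    then show ?thesis using b by simp
  qed
  then have "q dvd (\<Sum>orb\<in>orbits G E \<phi>. card orb)"
    by (rule dvd_sum)
  then show False
    using disjoint_sum[OF assms(3), of "\<lambda>_. 1::nat"] assms(4) by (simp only: card_eq_sum not_True_eq_False)
qed

lemma (in group) rcosets_action:
  assumes "subgroup Q G"
  shows "group_action G (rcosets Q) (\<lambda>g. \<lambda>C\<in>rcosets Q. C #> inv g)"
proof -
  have Q: "Q \<subseteq> carrier G" using assms by (rule subgroup.subset)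
  have closed: "C #> g \<in> rcosets Q" if "C \<in> rcosets Q" "g \<in> carrier G" for C g
    using that Q by (auto simp: RCOSETS_def coset_mult_assoc)
  have sub: "C \<subseteq> carrier G" if "C \<in> rcosets Q" for C
    using subgroup.rcosets_carrier[OF assms is_group that] .
  have bij: "(\<lambda>C\<in>rcosets Q. C #> inv g) \<in> Bij (rcosets Q)" if g: "g \<in> carrier G" for g
  proof -
    have "bij_betw (\<lambda>C. C #> inv g) (rcosets Q) (rcosets Q)"
      by (rule bij_betw_byWitness[where f' = "\<lambda>C. C #> g"])
        (use g sub closed in \<open>auto simp: coset_mult_assoc\<close>)
    then show ?thesis by (simp add: Bij_def bij_betw_restrict_eq)
  qed
  show ?thesis
    unfolding group_action_def group_hom_def group_hom_axioms_def
  proof (intro conjI homI group_BijGroup is_group)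
    show "(\<lambda>C\<in>rcosets Q. C #> inv g) \<in> carrier (BijGroup (rcosets Q))" if "g \<in> carrier G" for g
      using bij[OF that] by (simp add: BijGroup_def)
    show "(\<lambda>C\<in>rcosets Q. C #> inv (g \<otimes> h)) =
        (\<lambda>C\<in>rcosets Q. C #> inv g) \<otimes>\<^bsub>BijGroup (rcosets Q)\<^esub> (\<lambda>C\<in>rcosets Q. C #> inv h)"
      if g: "g \<in> carrier G" and h: "h \<in> carrier G" for g h
      using bij[OF g] bij[OF h] closed sub g h
      by (auto simp: BijGroup_def compose_def coset_mult_assoc inv_mult_group intro!: restrict_ext)
  qed
qed

text \<open>
  The group \<open>R\<close> acts on the right cosets of \<open>Q\<close> by multiplication, and \<open>Q #> g\<close> is a fixed
  point exactly if \<open>g \<otimes> R \<otimes> inv g\<close> lies in \<open>Q\<close>. This is the conjugacy part of Sylow's theorem,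
  stated for any subgroup \<open>Q\<close> of index prime to \<open>q\<close>.
\<close>

lemma (in group) p_subgroup_conjugate_into:
  assumes fin: "finite (carrier G)" and q: "Factorial_Ring.prime q"
    and R: "subgroup R G" "card R = q ^ a"
    and Q: "subgroup Q G" "\<not> q dvd card (rcosets Q)"
  shows "\<exists>g\<in>carrier G. \<forall>r\<in>R. g \<otimes> r \<otimes> inv g \<in> Q"
proof -
  interpret act: group_action "G\<lparr>carrier := R\<rparr>" "rcosets Q" "\<lambda>g. \<lambda>C\<in>rcosets Q. C #> inv g"
    using group_action.induced_action[OF rcosets_action[OF Q(1)] R(1)] .
  have "finite (rcosets Q)"
    using fin by (simp add: RCOSETS_def)
  then obtain C where C: "C \<in> rcosets Q" "\<forall>r\<in>R. C #> inv r = C"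
    using act.p_group_fixed_point[of q a] q R(2) Q(2) by (auto simp: order_def)
  then obtain g where g: "g \<in> carrier G" "C = Q #> g" by (auto simp: RCOSETS_def)
  have "g \<otimes> r \<otimes> inv g \<in> Q" if r: "r \<in> R" for r
  proof -
    have rG: "r \<in> carrier G" using r R(1) subgroup.mem_carrier by metis
    have "g \<in> Q #> g" using rcos_self[OF g(1) Q(1)] .
    then have "g \<in> Q #> g #> inv (inv r)"
      using C(2) g(2) R(1) r subgroup.m_inv_closed by metis
    then obtain y where y: "y \<in> Q" "g = y \<otimes> g \<otimes> r" using rG by (auto simp: r_coset_def)
    have yG: "y \<in> carrier G" using y(1) Q(1) subgroup.mem_carrier by metis
    have "inv y \<otimes> g = inv y \<otimes> (y \<otimes> g \<otimes> r)" using y(2) by simp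
    then have "inv y = g \<otimes> r \<otimes> inv g"
      using yG g(1) rG by (metis inv_cancel_left(1) inv_closed inv_solve_right m_assoc m_closed)
    then show ?thesis using y(1) Q(1) subgroup.m_inv_closed by metis
  qed
  then show ?thesis using g(1) by blast
qed

lemma (in group) p_subgroup_conjugate_into_within:
  assumes H: "subgroup H G" "finite H" and q: "Factorial_Ring.prime q"
    and R: "subgroup R G" "R \<subseteq> H" "card R = q ^ a"
    and Q: "subgroup Q G" "Q \<subseteq> H" "card H = n * card Q" "\<not> q dvd n"
  shows "\<exists>g\<in>H. \<forall>r\<in>R. g \<otimes> r \<otimes> inv g \<in> Q"
proof -
  interpret H: group "G\<lparr>carrier := H\<rparr>" using H(1) by (rule subgroup_imp_group)
  have QH: "subgroup Q (G\<lparr>carrier := H\<rparr>)" and RH: "subgroup R (G\<lparr>carrier := H\<rparr>)"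
    using subgroup_incl H(1) R Q by auto
  have "finite Q" using H(2) Q(2) by (rule rev_finite_subset)
  moreover have "Q \<noteq> {}" using subgroup.one_closed[OF Q(1)] by blast
  ultimately have "card Q > 0" by (simp add: card_gt_0_iff)
  then have "card (rcosets\<^bsub>G\<lparr>carrier := H\<rparr>\<^esub> Q) = n"
    using H.lagrange[OF QH] Q(3) by (simp add: order_def)
  then obtain g where g: "g \<in> H"
      "\<forall>r\<in>R. g \<otimes> r \<otimes> inv\<^bsub>G\<lparr>carrier := H\<rparr>\<^esub> g \<in> Q"
    using H.p_subgroup_conjugate_into[OF _ q RH R(3) QH] H(2) Q(4) by auto
  then have "\<forall>r\<in>R. g \<otimes> r \<otimes> inv g \<in> Q" using H(1) by simp
  then show ?thesis using g(1) by blast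
qed

section \<open>Finite nilpotent groups\<close>

lemma (in group) lower_central_series_subset: "lower_central_series G n \<subseteq> carrier G"
proof (induction n)
  case (Suc n)
  have "generate G (\<Union>h\<in>lower_central_series G n. \<Union>k\<in>carrier G. {h \<otimes> k \<otimes> inv h \<otimes> inv k}) \<subseteq> carrier G"
    using Suc by (intro generate_incl) (auto simp: subset_iff)
  then show ?case by (simp add: commutator_subgroup_def)
qed simp

text \<open>
  Let \<open>i\<close> be the last index whose term of the lower central series is not contained in \<open>H\<close>. The
  commutators of that term with \<open>H\<close> lie in the next term, hence in \<open>H\<close>; so every element of the
  \<open>i\<close>-th term normalizes \<open>H\<close>.
\<close>

lemma (in group) nilpotent_normalizer_grows:
  assumes "nilpotent_group G" "subgroup H G" "H \<noteq> carrier G"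
  shows "\<exists>x\<in>carrier G - H. \<forall>h\<in>H. x \<otimes> h \<otimes> inv x \<in> H"
proof -
  obtain n where "lower_central_series G n = {\<one>}" using assms(1) by (auto simp: nilpotent_group_def)
  then have ex: "\<exists>n. lower_central_series G n \<subseteq> H"
    using subgroup.one_closed[OF assms(2)] by (metis empty_subsetI insert_subset)
  define m where "m = (LEAST n. lower_central_series G n \<subseteq> H)"
  have m: "lower_central_series G m \<subseteq> H" unfolding m_def using ex by (rule LeastI_ex)
  have "m \<noteq> 0"
    using m assms(3) subgroup.subset[OF assms(2)] by (metis lower_central_series.simps(1) subset_antisym)
  then obtain i where i: "m = Suc i" using not0_implies_Suc by blast
  have "\<not> lower_central_series G i \<subseteq> H"
    using not_less_Least[of i "\<lambda>n. lower_central_series G n \<subseteq> H"] i m_def by simp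
  then obtain x where x: "x \<in> lower_central_series G i" "x \<notin> H" by blast
  have xG: "x \<in> carrier G" using x(1) lower_central_series_subset by blast
  have "x \<otimes> h \<otimes> inv x \<in> H" if h: "h \<in> H" for h
  proof -
    have hG: "h \<in> carrier G" using h assms(2) subgroup.mem_carrier by metis
    have "x \<otimes> h \<otimes> inv x \<otimes> inv h \<in> lower_central_series G m"
      unfolding i using x(1) hG
      by (auto simp: commutator_subgroup_def intro!: generate.incl)
    then have "x \<otimes> h \<otimes> inv x \<otimes> inv h \<otimes> h \<in> H"
      using m h assms(2) by (meson subgroup.m_closed subsetD)
    then show ?thesis using xG hG by (simp add: m_assoc)
  qed
  then show ?thesis using x(2) xG by blast
qed

text \<open>
  Only \<open>g \<otimes> P \<otimes> inv g \<subseteq> P\<close> is required of \<open>g\<close>. As \<open>P\<close> is finite, equality follows, and with it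
  closure under inverses.
\<close>

lemma (in group) subgroup_finite_normalizer:
  assumes "subgroup P G" "finite P"
  shows "subgroup {g \<in> carrier G. \<forall>h\<in>P. g \<otimes> h \<otimes> inv g \<in> P} G"
proof -
  have P: "P \<subseteq> carrier G" using assms(1) by (rule subgroup.subset)
  show ?thesis
  proof (rule subgroupI)
    show "{g \<in> carrier G. \<forall>h\<in>P. g \<otimes> h \<otimes> inv g \<in> P} \<noteq> {}" using P by (auto intro!: exI[of _ \<one>])
  next
    fix a b
    assume a: "a \<in> {g \<in> carrier G. \<forall>h\<in>P. g \<otimes> h \<otimes> inv g \<in> P}"
      and b: "b \<in> {g \<in> carrier G. \<forall>h\<in>P. g \<otimes> h \<otimes> inv g \<in> P}"
    have "a \<otimes> b \<otimes> h \<otimes> inv (a \<otimes> b) = a \<otimes> (b \<otimes> h \<otimes> inv b) \<otimes> inv a" if "h \<in> P" for h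
      using a b that P by (auto simp: word_simps subset_iff)
    then show "a \<otimes> b \<in> {g \<in> carrier G. \<forall>h\<in>P. g \<otimes> h \<otimes> inv g \<in> P}"
      using a b by auto
  next
    fix a assume a: "a \<in> {g \<in> carrier G. \<forall>h\<in>P. g \<otimes> h \<otimes> inv g \<in> P}"
    then have "(\<lambda>x. a \<otimes> x \<otimes> inv a) ` P = P"
      using card_conjugate_image[OF P, of a] by (intro card_subset_eq assms(2)) auto
    then have "inv a \<otimes> h \<otimes> inv (inv a) \<in> P" if h: "h \<in> P" for h
    proof -
      obtain k where k: "k \<in> P" "h = a \<otimes> k \<otimes> inv a"
        using h \<open>(\<lambda>x. a \<otimes> x \<otimes> inv a) ` P = P\<close> by blast
      then have "inv a \<otimes> h \<otimes> inv (inv a) = k" using a subsetD[OF P k(1)] by (simp add: word_simps)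
      then show ?thesis using k(1) by simp
    qed
    then show "inv a \<in> {g \<in> carrier G. \<forall>h\<in>P. g \<otimes> h \<otimes> inv g \<in> P}" using a by simp
  qed auto
qed

text \<open>
  The normalizer \<open>M\<close> of a Sylow subgroup \<open>P\<close> is its own normalizer: if \<open>x\<close> normalizes \<open>M\<close>, then
  the conjugate of \<open>P\<close> by \<open>x\<close> is again a \<open>p\<close>-subgroup of \<open>M\<close>, hence conjugate within \<open>M\<close> to a
  subgroup of \<open>P\<close>, hence contained in \<open>P\<close>. In a nilpotent group only the whole group is its own
  normalizer.
\<close>

lemma (in group) nilpotent_normal_sylow:
  assumes nil: "nilpotent_group G" and fin: "finite (carrier G)" and p: "Factorial_Ring.prime p"
  shows "\<exists>P. P \<lhd> G \<and> card P = p ^ multiplicity p (order G)"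
proof -
  have ord: "order G \<noteq> 0" using fin by (simp add: order_gt_0_iff_finite)
  have np: "\<not> is_unit p" using p by auto
  define n where "n = multiplicity p (order G)"
  obtain k where k: "order G = p ^ n * k" "\<not> p dvd k"
    using multiplicity_decompose'[OF ord np] unfolding n_def by blast
  obtain P where P: "subgroup P G" "card P = p ^ n"
    using sylow_thm[OF p is_group k(1) fin] by blast
  have PG: "P \<subseteq> carrier G" using P(1) by (rule subgroup.subset)
  have finP: "finite P" using PG fin finite_subset by blast
  define M where "M = {g \<in> carrier G. \<forall>h\<in>P. g \<otimes> h \<otimes> inv g \<in> P}"
  have M: "subgroup M G" unfolding M_def by (rule subgroup_finite_normalizer[OF P(1) finP])
  have finM: "finite M" using fin by (simp add: M_def)
  have PM: "P \<subseteq> M" using P(1) PG by (auto simp: M_def subgroup.m_closed subgroup.m_inv_closed)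
  have "M = carrier G"
  proof (rule ccontr)
    assume "M \<noteq> carrier G"
    then obtain x where x: "x \<in> carrier G" "x \<notin> M" "\<forall>h\<in>M. x \<otimes> h \<otimes> inv x \<in> M"
      using nilpotent_normalizer_grows[OF nil M] by blast
    define R where "R = (\<lambda>h. x \<otimes> h \<otimes> inv x) ` P"
    have R: "subgroup R G" "card R = p ^ n" "R \<subseteq> M"
      using subgroup_conjugate_image[OF P(1) x(1)] card_conjugate_image[OF PG x(1)] P(2) PM x(3)
      by (auto simp: R_def)
    obtain c where c: "card M = c * card P"
      using card_subgroup_dvd[OF P(1) M PM finM] by (metis dvd_def mult.commute)
    have "card M dvd order G"
      using card_subgroup_dvd[OF M subgroup_self] M subgroup.subset fin by (metis order_def)
    then obtain d where "p ^ n * k = c * p ^ n * d" using c k P(2) by (metis dvd_def)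
    then have "k = c * d" using p prime_gt_0_nat by auto
    then have "\<not> p dvd c" using k(2) by auto
    then obtain g where g: "g \<in> M" "\<forall>r\<in>R. g \<otimes> r \<otimes> inv g \<in> P"
      using p_subgroup_conjugate_into_within[OF M finM p R(1,3,2) P(1) PM c] by blast
    have ig: "inv g \<in> M" using g(1) M by (simp add: subgroup.m_inv_closed)
    have gG: "g \<in> carrier G" using g(1) by (simp add: M_def)
    have "x \<otimes> h \<otimes> inv x \<in> P" if h: "h \<in> P" for h
    proof -
      have hG: "h \<in> carrier G" using h PG by blast
      have "inv g \<otimes> (g \<otimes> (x \<otimes> h \<otimes> inv x) \<otimes> inv g) \<otimes> inv (inv g) \<in> P"
        using g(2) h ig by (auto simp: R_def M_def)
      then show ?thesis using gG hG x(1) by (simp add: word_simps)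
    qed
    then show False using x(1,2) by (simp add: M_def)
  qed
  then have "P \<lhd> G" using P(1) by (auto simp: normal_inv_iff M_def)
  then show ?thesis using P(2) n_def by blast
qed

text \<open>
  For a nilpotent subgroup \<open>H\<close> this is its unique Sylow \<open>p\<close>-subgroup. Describing it by the orders of
  its elements makes it visibly invariant under every conjugation that preserves \<open>H\<close>, so that for a
  normal subgroup it is normal in the whole group.
\<close>

definition p_part :: "('a, 'b) monoid_scheme \<Rightarrow> 'a set \<Rightarrow> nat \<Rightarrow> 'a set" where
  "p_part G H p = {x \<in> H. \<exists>k :: nat. x [^]\<^bsub>G\<^esub> (p ^ k) = \<one>\<^bsub>G\<^esub>}"

lemma p_part_subset: "p_part G H p \<subseteq> H"
  by (auto simp: p_part_def)

text \<open>
  The cyclic group generated by an element of \<open>p\<close>-power order is a \<open>p\<close>-subgroup, so it is conjugate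
  into \<open>P\<close>, and \<open>P\<close> is normal.
\<close>

lemma (in group) normal_sylow_eq_p_part:
  assumes fin: "finite (carrier G)" and p: "Factorial_Ring.prime p"
    and P: "P \<lhd> G" "card P = p ^ multiplicity p (order G)"
  shows "P = p_part G (carrier G) p"
proof
  have Psub: "subgroup P G" using P(1) by (rule normal_imp_subgroup)
  show "P \<subseteq> p_part G (carrier G) p"
  proof
    fix x assume x: "x \<in> P"
    interpret P: group "G\<lparr>carrier := P\<rparr>" using Psub by (rule subgroup_imp_group)
    have "x [^]\<^bsub>G\<lparr>carrier := P\<rparr>\<^esub> order (G\<lparr>carrier := P\<rparr>) = \<one>\<^bsub>G\<lparr>carrier := P\<rparr>\<^esub>"
      using x by (intro P.pow_order_eq_1) simp
    then have "x [^] (p ^ multiplicity p (order G)) = \<one>"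
      using P(2) by (simp add: order_def nat_pow_consistent[symmetric])
    moreover have "x \<in> carrier G" using subgroup.mem_carrier[OF Psub x] .
    ultimately show "x \<in> p_part G (carrier G) p" by (auto simp: p_part_def)
  qed
  show "p_part G (carrier G) p \<subseteq> P"
  proof
    fix x assume "x \<in> p_part G (carrier G) p"
    then obtain k :: nat where x: "x \<in> carrier G" "x [^] (p ^ k) = \<one>" by (auto simp: p_part_def)
    define R where "R = generate G {x}"
    have R: "subgroup R G" "x \<in> R"
      using x(1) by (auto simp: R_def generate.incl intro!: generate_is_subgroup)
    have "card R dvd p ^ k"
      using generate_pow_card[OF x(1)] pow_eq_id[OF x(1)] x(2) by (simp add: R_def)
    then obtain a where a: "card R = p ^ a" using p divides_primepow_nat by blast
    have ord: "order G \<noteq> 0" using fin by (simp add: order_gt_0_iff_finite)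
    have np: "\<not> is_unit p" using p by auto
    obtain m where m: "order G = p ^ multiplicity p (order G) * m" "\<not> p dvd m"
      using multiplicity_decompose'[OF ord np] by blast
    have "card (rcosets P) * card P = order G" by (rule lagrange[OF Psub])
    then have "card (rcosets P) * p ^ multiplicity p (order G) = m * p ^ multiplicity p (order G)"
      using P(2) m(1) by (metis mult.commute)
    then have "card (rcosets P) = m" using p prime_gt_0_nat by simp
    then obtain g where g: "g \<in> carrier G" "\<forall>r\<in>R. g \<otimes> r \<otimes> inv g \<in> P"
      using p_subgroup_conjugate_into[OF fin p R(1) a Psub] m(2) by blast
    then have "inv g \<otimes> (g \<otimes> x \<otimes> inv g) \<otimes> inv (inv g) \<in> P"
      using P(1) R(2) by (meson inv_closed normal_inv_iff)
    then show "x \<in> P" using g(1) x(1) by (simp add: word_simps)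
  qed
qed

lemma (in group) nilpotent_p_part:
  assumes H: "subgroup H G" "finite H" "nilpotent_group (G\<lparr>carrier := H\<rparr>)"
    and p: "Factorial_Ring.prime p"
  shows "subgroup (p_part G H p) G" and "card (p_part G H p) = p ^ multiplicity p (card H)"
proof -
  interpret H: group "G\<lparr>carrier := H\<rparr>" using H(1) by (rule subgroup_imp_group)
  obtain P where P: "P \<lhd> G\<lparr>carrier := H\<rparr>" "card P = p ^ multiplicity p (order (G\<lparr>carrier := H\<rparr>))"
    using H.nilpotent_normal_sylow[OF H(3) _ p] H(2) by auto
  have "P = p_part (G\<lparr>carrier := H\<rparr>) (carrier (G\<lparr>carrier := H\<rparr>)) p"
    using H.normal_sylow_eq_p_part[OF _ p P] H(2) by simp
  also have "\<dots> = p_part G H p"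
    by (simp add: p_part_def nat_pow_consistent[symmetric])
  finally have eq: "P = p_part G H p" .
  show "subgroup (p_part G H p) G"
    using incl_subgroup[OF H(1)] normal_imp_subgroup[OF P(1)] eq by simp
  show "card (p_part G H p) = p ^ multiplicity p (card H)"
    using P(2) eq by (simp add: order_def)
qed

lemma (in group) conjugate_pow:
  assumes "g \<in> carrier G" "x \<in> carrier G"
  shows "(g \<otimes> x \<otimes> inv g) [^] (n :: nat) = g \<otimes> x [^] n \<otimes> inv g"
proof (induction n)
  case (Suc n)
  have "(g \<otimes> x \<otimes> inv g) [^] Suc n = (g \<otimes> x [^] n \<otimes> inv g) \<otimes> (g \<otimes> x \<otimes> inv g)"
    using Suc by simp
  also have "\<dots> = g \<otimes> x [^] Suc n \<otimes> inv g" using assms by (simp add: word_simps)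
  finally show ?case .
qed (use assms in simp)

lemma (in group) p_part_conjugate:
  assumes "x \<in> p_part G H p" "H \<subseteq> carrier G" "g \<in> carrier G" "g \<otimes> x \<otimes> inv g \<in> H"
  shows "g \<otimes> x \<otimes> inv g \<in> p_part G H p"
proof -
  obtain k :: nat where k: "x \<in> H" "x [^] (p ^ k) = \<one>" using assms(1) by (auto simp: p_part_def)
  then have "(g \<otimes> x \<otimes> inv g) [^] (p ^ k) = \<one>"
    using conjugate_pow[of g x "p ^ k"] assms by auto
  then show ?thesis using assms(4) unfolding p_part_def by blast
qed

lemma (in group) normal_p_part:
  assumes "N \<lhd> G" "finite N" "nilpotent_group (G\<lparr>carrier := N\<rparr>)" "Factorial_Ring.prime p"
  shows "p_part G N p \<lhd> G"
proof -
  have N: "subgroup N G" using assms(1) by (rule normal_imp_subgroup)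
  show ?thesis
    unfolding normal_inv_iff
  proof (intro conjI ballI)
    show "subgroup (p_part G N p) G" using nilpotent_p_part(1)[OF N assms(2-4)] .
    fix g x assume gx: "g \<in> carrier G" "x \<in> p_part G N p"
    then have "g \<otimes> x \<otimes> inv g \<in> N"
      using assms(1) p_part_subset[of G N p] by (auto simp: normal_inv_iff)
    then show "g \<otimes> x \<otimes> inv g \<in> p_part G N p"
      using p_part_conjugate[OF gx(2) subgroup.subset[OF N] gx(1)] by simp
  qed
qed

lemma (in group) p_parts_inter:
  assumes "Factorial_Ring.prime p" "Factorial_Ring.prime q" "p \<noteq> q"
    and "x \<in> p_part G H p" "x \<in> p_part G H q" "H \<subseteq> carrier G"
  shows "x = \<one>"
proof -
  have x: "x \<in> carrier G" using assms(4,6) by (auto simp: p_part_def)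
  obtain k l :: nat where "x [^] (p ^ k) = \<one>" "x [^] (q ^ l) = \<one>"
    using assms(4,5) by (auto simp: p_part_def)
  then have "ord x dvd p ^ k" "ord x dvd q ^ l" using pow_eq_id[OF x] by simp_all
  moreover have "coprime (p ^ k) (q ^ l)"
    using assms(1-3) by (simp add: primes_coprime)
  ultimately have "ord x dvd 1" by (metis coprime_common_divisor is_unit_gcd one_dvd)
  then have "x [^] (1::nat) = \<one>" using pow_eq_id[OF x] by blast
  then show ?thesis using x by simp
qed

lemma (in group) commute_if_commutator_one:
  assumes "x \<in> carrier G" "y \<in> carrier G" "x \<otimes> y \<otimes> inv x \<otimes> inv y = \<one>"
  shows "x \<otimes> y = y \<otimes> x"
proof -
  have "x \<otimes> y = (x \<otimes> y \<otimes> inv x \<otimes> inv y) \<otimes> (y \<otimes> x)"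
    using assms(1,2) by (simp add: word_simps)
  then show ?thesis using assms by simp
qed

text \<open>
  Both factors are normal in \<open>H\<close>, so the commutator of \<open>x\<close> and \<open>y\<close> lies in their intersection,
  where the order of an element is a power of \<open>p\<close> and of \<open>q\<close>.
\<close>

lemma (in group) nilpotent_p_parts_commute:
  assumes H: "subgroup H G" "finite H" "nilpotent_group (G\<lparr>carrier := H\<rparr>)"
    and "Factorial_Ring.prime p" "Factorial_Ring.prime q" "p \<noteq> q"
    and x: "x \<in> p_part G H p" and y: "y \<in> p_part G H q"
  shows "x \<otimes> y = y \<otimes> x"
proof -
  have HG: "H \<subseteq> carrier G" using H(1) by (rule subgroup.subset)
  have xy: "x \<in> H" "y \<in> H" using x y by (auto simp: p_part_def)
  then have xyG: "x \<in> carrier G" "y \<in> carrier G" using HG by auto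
  note P = nilpotent_p_part(1)[OF H assms(4)] and Q = nilpotent_p_part(1)[OF H assms(5)]
  have "y \<otimes> inv x \<otimes> inv y \<in> p_part G H p"
    using P x xy H(1) xyG
    by (intro p_part_conjugate HG subgroup.m_closed[OF H(1)] subgroup.m_inv_closed) auto
  then have "x \<otimes> (y \<otimes> inv x \<otimes> inv y) \<in> p_part G H p"
    using P x by (simp add: subgroup.m_closed)
  moreover have "x \<otimes> y \<otimes> inv x \<in> p_part G H q"
    using y xy H(1) xyG
    by (intro p_part_conjugate HG subgroup.m_closed[OF H(1)] subgroup.m_inv_closed) auto
  then have "x \<otimes> y \<otimes> inv x \<otimes> inv y \<in> p_part G H q"
    using Q y by (simp add: subgroup.m_closed subgroup.m_inv_closed)
  ultimately have "x \<otimes> y \<otimes> inv x \<otimes> inv y = \<one>"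
    using xyG by (intro p_parts_inter[OF assms(4-6) _ _ HG]) (simp_all add: m_assoc)
  then show ?thesis using xyG by (rule commute_if_commutator_one[rotated 2])
qed

text \<open>
  The order of \<open>D\<close> is divisible by every prime power that exactly divides the order of \<open>H\<close>.
\<close>

lemma (in group) subgroup_containing_p_parts:
  assumes H: "subgroup H G" "finite H" "nilpotent_group (G\<lparr>carrier := H\<rparr>)"
    and D: "subgroup D G" "D \<subseteq> H"
    and parts: "\<And>p. Factorial_Ring.prime p \<Longrightarrow> p dvd card H \<Longrightarrow> p_part G H p \<subseteq> D"
  shows "D = H"
proof -
  have finD: "finite D" using D(2) H(2) by (rule finite_subset)
  have pos: "card D > 0" "card H > 0"
    using subgroup.finite_imp_card_positive D(1) H(1) finD H(2) subgroup.one_closed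
    by (metis card_gt_0_iff empty_iff)+
  have "multiplicity p (card H) \<le> multiplicity p (card D)" if p: "Factorial_Ring.prime p" for p
  proof (cases "p dvd card H")
    case True
    have "p ^ multiplicity p (card H) dvd card D"
      using card_subgroup_dvd[OF nilpotent_p_part(1)[OF H p] D(1) parts[OF p True] finD]
        nilpotent_p_part(2)[OF H p] by simp
    then show ?thesis using pos p by (intro multiplicity_geI) auto
  qed (simp add: not_dvd_imp_multiplicity_0)
  then have "card H dvd card D"
    using pos by (intro multiplicity_le_imp_dvd) auto
  then have "card H \<le> card D" using pos by (simp add: dvd_imp_le)
  then show ?thesis using D(2) H(2) by (simp add: card_seteq)
qed

section \<open>Products of subgroups and Hall subgroups\<close>

lemma (in group) inter_trivial_if_coprime_card:
  assumes "subgroup A G" "subgroup B G" "finite A" "finite B" "coprime (card A) (card B)"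
  shows "A \<inter> B = {\<one>}"
proof -
  have sub: "subgroup (A \<inter> B) G" using subgroups_Inter_pair assms by blast
  have "card (A \<inter> B) dvd card A" "card (A \<inter> B) dvd card B"
    using card_subgroup_dvd[OF sub] assms by auto
  then have "card (A \<inter> B) = 1" using assms(5) by (metis coprime_common_divisor_nat)
  then show ?thesis
    using subgroup.one_closed[OF sub] by (metis card_1_singletonE singletonD)
qed

lemma (in group) card_set_mult_trivial_inter:
  assumes "subgroup A G" "subgroup B G" "A \<inter> B = {\<one>}"
  shows "card (A <#> B) = card A * card B"
proof -
  have AB: "A \<subseteq> carrier G" "B \<subseteq> carrier G" using assms subgroup.subset by auto
  have "inj_on (\<lambda>(a, b). a \<otimes> b) (A \<times> B)"
  proof (rule inj_onI, clarify)
    fix a b c d assume a: "a \<in> A" and b: "b \<in> B" and c: "c \<in> A" and d: "d \<in> B"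
      and eq: "a \<otimes> b = c \<otimes> d"
    have G: "a \<in> carrier G" "b \<in> carrier G" "c \<in> carrier G" "d \<in> carrier G"
      using a b c d AB by auto
    have "inv c \<otimes> (a \<otimes> b) \<otimes> inv b = inv c \<otimes> (c \<otimes> d) \<otimes> inv b" using eq by simp
    then have eq': "inv c \<otimes> a = d \<otimes> inv b" using G by (simp add: word_simps)
    have "inv c \<otimes> a \<in> A" using a c assms(1) by (simp add: subgroup.m_closed subgroup.m_inv_closed)
    moreover have "d \<otimes> inv b \<in> B"
      using b d assms(2) by (simp add: subgroup.m_closed subgroup.m_inv_closed)
    ultimately have "inv c \<otimes> a = \<one>" "d \<otimes> inv b = \<one>" using eq' assms(3) by auto
    then show "a = c \<and> b = d" using G
      by (metis inv_closed inv_equality inv_inv)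
  qed
  moreover have "A <#> B = (\<lambda>(a, b). a \<otimes> b) ` (A \<times> B)" by (auto simp: set_mult_def)
  ultimately show ?thesis by (simp add: card_image card_cartesian_product)
qed

lemma (in group) subgroup_set_mult_normal:
  assumes "A \<lhd> G" "subgroup B G"
  shows "subgroup (A <#> B) G"
  by (intro second_isomorphism_grp.normal_set_mult_subgroup second_isomorphism_grp.intro
      second_isomorphism_grp_axioms.intro assms)

lemma (in group) subset_set_mult:
  assumes "subgroup A G" "subgroup B G"
  shows "A \<subseteq> A <#> B" and "B \<subseteq> A <#> B"
  using assms[THEN subgroup.one_closed] assms[THEN subgroup.mem_carrier]
  by (force simp: set_mult_def)+

lemma (in group) dedekind_modular_law:
  assumes "subgroup A G" "subgroup B G" "subgroup H G" "A \<subseteq> H" "H \<subseteq> A <#> B"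
  shows "A <#> (B \<inter> H) = H"
proof
  show "A <#> (B \<inter> H) \<subseteq> H"
    using assms(4) subgroup.m_closed[OF assms(3)] by (auto simp: set_mult_def)
  show "H \<subseteq> A <#> (B \<inter> H)"
  proof
    fix h assume h: "h \<in> H"
    then have "h \<in> A <#> B" using assms(5) by blast
    then obtain a b where ab: "a \<in> A" "b \<in> B" "h = a \<otimes> b" by (auto simp: set_mult_def)
    have "b = inv a \<otimes> h"
      using ab assms(1,2)[THEN subgroup.mem_carrier] by (simp add: word_simps)
    also have "\<dots> \<in> H"
      using ab(1) h assms(3,4) by (auto intro: subgroup.m_closed subgroup.m_inv_closed)
    finally show "h \<in> A <#> (B \<inter> H)" using ab by (auto simp: set_mult_def)
  qed
qed

lemma (in group) normal_set_mult:
  assumes "A \<lhd> G" "B \<lhd> G"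
  shows "A <#> B \<lhd> G"
  unfolding normal_inv_iff
proof (intro conjI ballI)
  show "subgroup (A <#> B) G" by (rule subgroup_set_mult_normal[OF assms(1) normal_imp_subgroup[OF assms(2)]])
  fix g x assume g: "g \<in> carrier G" and "x \<in> A <#> B"
  then obtain a b where ab: "a \<in> A" "b \<in> B" "x = a \<otimes> b" by (auto simp: set_mult_def)
  then have G: "a \<in> carrier G" "b \<in> carrier G"
    using assms[THEN normal_imp_subgroup, THEN subgroup.mem_carrier] by auto
  have "g \<otimes> x \<otimes> inv g = (g \<otimes> a \<otimes> inv g) \<otimes> (g \<otimes> b \<otimes> inv g)"
    using G g ab by (simp add: word_simps)
  moreover have "g \<otimes> a \<otimes> inv g \<in> A" "g \<otimes> b \<otimes> inv g \<in> B"
    using ab g assms by (auto simp: normal_inv_iff)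
  ultimately show "g \<otimes> x \<otimes> inv g \<in> A <#> B" by (auto simp: set_mult_def)
qed

text \<open>
  The Hall \<open>\<pi>\<close>-subgroup of a nilpotent normal subgroup is the product of its Sylow subgroups for the
  primes in \<open>\<pi>\<close>. Normality in the whole group is what makes it usable below.
\<close>

lemma (in group) nilpotent_hall:
  assumes N: "N \<lhd> G" "finite N" "nilpotent_group (G\<lparr>carrier := N\<rparr>)"
    and "finite \<pi>" "\<And>q. q \<in> \<pi> \<Longrightarrow> Factorial_Ring.prime q"
  shows "\<exists>A. A \<lhd> G \<and> A \<subseteq> N \<and> (\<forall>q\<in>\<pi>. p_part G N q \<subseteq> A) \<and>
    (\<forall>r. Factorial_Ring.prime r \<longrightarrow> r dvd card A \<longrightarrow> r \<in> \<pi>)"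
  using assms(4,5)
proof (induction \<pi>)
  case empty
  have "{\<one>} \<lhd> G" by (simp add: one_is_normal)
  then show ?case using subgroup.one_closed[OF normal_imp_subgroup[OF N(1)]]
    by (intro exI[of _ "{\<one>}"]) (auto dest: not_prime_unit)
next
  case (insert q \<pi>)
  have q: "Factorial_Ring.prime q" using insert.prems by simp
  have Nsub: "subgroup N G" using N(1) by (rule normal_imp_subgroup)
  obtain A where A: "A \<lhd> G" "A \<subseteq> N" "\<forall>q\<in>\<pi>. p_part G N q \<subseteq> A"
    "\<forall>r. Factorial_Ring.prime r \<longrightarrow> r dvd card A \<longrightarrow> r \<in> \<pi>"
    using insert.IH insert.prems by auto
  define Q where "Q = p_part G N q"
  have Q: "Q \<lhd> G" "card Q = q ^ multiplicity q (card N)" "Q \<subseteq> N"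
    unfolding Q_def using normal_p_part[OF N q] nilpotent_p_part(2)[OF Nsub N(2,3) q] p_part_subset[of G N]
    by auto
  have subs: "subgroup A G" "subgroup Q G" using A(1) Q(1) by (auto intro: normal_imp_subgroup)
  have fins: "finite A" "finite Q" using A(2) Q(3) N(2) finite_subset by auto
  have "\<not> q dvd card A" using A(4) q insert.hyps by blast
  then have "coprime (card A) (card Q)"
    using q Q(2) by (metis coprime_commute coprime_power_left_iff prime_imp_coprime_nat)
  then have "A \<inter> Q = {\<one>}" using inter_trivial_if_coprime_card subs fins by blast
  then have card: "card (A <#> Q) = card A * card Q" by (rule card_set_mult_trivial_inter[OF subs])
  have "A \<subseteq> A <#> Q" "Q \<subseteq> A <#> Q"
    using subset_set_mult subs by auto
  moreover have "A <#> Q \<subseteq> N"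
    using A(2) Q(3) subgroup.m_closed[OF Nsub] by (auto simp: set_mult_def)
  moreover have "r \<in> insert q \<pi>" if r: "Factorial_Ring.prime r" "r dvd card (A <#> Q)" for r
  proof -
    have "r dvd card A \<or> r dvd q ^ multiplicity q (card N)"
      using r card Q(2) by (simp add: prime_dvd_mult_iff)
    then show ?thesis using A(4) r(1) q by (metis insertCI prime_dvd_power primes_dvd_imp_eq)
  qed
  moreover have "p_part G N q' \<subseteq> A <#> Q" if "q' \<in> insert q \<pi>" for q'
    using that A(3) \<open>A \<subseteq> A <#> Q\<close> \<open>Q \<subseteq> A <#> Q\<close> by (auto simp: Q_def)
  ultimately show ?case using normal_set_mult[OF A(1) Q(1)] by blast
qed

text \<open>
  The group \<open>A\<close> is the product of the Sylow subgroups of \<open>N\<close> for the primes other than \<open>p\<close>. It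
  will play the role of the kernel of the projection of \<open>N\<close> onto its \<open>p\<close>-part.
\<close>

lemma (in group) nilpotent_p_complement:
  assumes N: "N \<lhd> G" "finite N" "nilpotent_group (G\<lparr>carrier := N\<rparr>)"
    and p: "Factorial_Ring.prime p"
  obtains A where "A \<lhd> G" "A \<subseteq> N" "\<And>q. Factorial_Ring.prime q \<Longrightarrow> q \<noteq> p \<Longrightarrow> p_part G N q \<subseteq> A"
    "\<not> p dvd card A" "p_part G N p \<inter> A = {\<one>}" "p_part G N p <#> A = N"
proof -
  have Nsub: "subgroup N G" using N(1) by (rule normal_imp_subgroup)
  have cardN: "card N > 0" using subgroup.one_closed[OF Nsub] N(2) by (auto simp: card_gt_0_iff)
  obtain A where A: "A \<lhd> G" "A \<subseteq> N" "\<forall>q\<in>prime_factors (card N) - {p}. p_part G N q \<subseteq> A"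
    "\<forall>r. Factorial_Ring.prime r \<longrightarrow> r dvd card A \<longrightarrow> r \<in> prime_factors (card N) - {p}"
    using nilpotent_hall[OF N, of "prime_factors (card N) - {p}"] by (metis (no_types, lifting) Diff_iff finite_Diff finite_set_mset in_prime_factors_imp_prime)
  have Asub: "subgroup A G" using A(1) by (rule normal_imp_subgroup)
  have parts: "p_part G N q \<subseteq> A" if q: "Factorial_Ring.prime q" "q \<noteq> p" for q
  proof (cases "q dvd card N")
    case True
    then have "q \<in> prime_factors (card N) - {p}" using q cardN by (simp add: in_prime_factors_iff)
    then show ?thesis using A(3) by blast
  next
    case False
    then have "card (p_part G N q) = 1"
      using nilpotent_p_part(2)[OF Nsub N(2,3) q(1)] by (simp add: not_dvd_imp_multiplicity_0)
    then have "p_part G N q = {\<one>}"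
      using subgroup.one_closed[OF nilpotent_p_part(1)[OF Nsub N(2,3) q(1)]]
      by (metis card_1_singletonE singletonD)
    then show ?thesis using subgroup.one_closed[OF Asub] by simp
  qed
  have ndvd: "\<not> p dvd card A" using A(4) p by blast
  define P where "P = p_part G N p"
  have P: "P \<lhd> G" "subgroup P G" "card P = p ^ multiplicity p (card N)" "P \<subseteq> N"
    unfolding P_def using normal_p_part[OF N p] nilpotent_p_part[OF Nsub N(2,3) p] p_part_subset[of G N]
    by auto
  have fins: "finite A" "finite P" using A(2) P(4) N(2) finite_subset by auto
  have "coprime (card P) (card A)"
    using p P(3) ndvd by (metis coprime_power_left_iff prime_imp_coprime_nat)
  then have inter: "P \<inter> A = {\<one>}" using inter_trivial_if_coprime_card P(2) Asub fins by blast
  have sup: "P \<subseteq> P <#> A" "A \<subseteq> P <#> A"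
    using subset_set_mult[OF P(2) Asub] by auto
  have "P <#> A = N"
  proof (rule subgroup_containing_p_parts[OF Nsub N(2,3)])
    show "subgroup (P <#> A) G" using subgroup_set_mult_normal[OF P(1) Asub] .
    show "P <#> A \<subseteq> N" using A(2) P(4) subgroup.m_closed[OF Nsub] by (auto simp: set_mult_def)
    show "p_part G N q \<subseteq> P <#> A" if "Factorial_Ring.prime q" for q
      using parts[OF that] sup by (cases "q = p") (auto simp: P_def)
  qed
  then show ?thesis using that[OF A(1,2) parts ndvd] inter by (simp add: P_def)
qed

section \<open>Complements inherit nilpotency from the quotient\<close>

lemma one_in_lower_central_series:
  assumes "group G"
  shows "\<one>\<^bsub>G\<^esub> \<in> lower_central_series G n"
proof (cases n)
  case 0
  then show ?thesis using assms by (simp add: group.is_monoid)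
next
  case (Suc i)
  then show ?thesis by (simp add: commutator_subgroup_def generate.one)
qed

lemma (in group_hom) hom_lower_central_series:
  "h ` lower_central_series G n \<subseteq> lower_central_series H n"
proof (induction n)
  case 0
  then show ?case using hom_closed by auto
next
  case (Suc n)
  let ?S = "\<lambda>F. \<Union>x\<in>lower_central_series F n. \<Union>y\<in>carrier F.
    {x \<otimes>\<^bsub>F\<^esub> y \<otimes>\<^bsub>F\<^esub> inv\<^bsub>F\<^esub> x \<otimes>\<^bsub>F\<^esub> inv\<^bsub>F\<^esub> y}"
  have sub: "?S G \<subseteq> carrier G"
    using G.lower_central_series_subset[of n] by (auto simp: subset_iff)
  have "h ` ?S G \<subseteq> ?S H"
  proof
    fix z assume "z \<in> h ` ?S G"
    then obtain x y where xy: "x \<in> lower_central_series G n" "y \<in> carrier G"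
      "z = h (x \<otimes> y \<otimes> inv x \<otimes> inv y)" by blast
    then have "x \<in> carrier G" using G.lower_central_series_subset by blast
    then have "z = h x \<otimes>\<^bsub>H\<^esub> h y \<otimes>\<^bsub>H\<^esub> inv\<^bsub>H\<^esub> h x \<otimes>\<^bsub>H\<^esub> inv\<^bsub>H\<^esub> h y"
      using xy by simp
    moreover have "h x \<in> lower_central_series H n" "h y \<in> carrier H" using Suc xy by auto
    ultimately show "z \<in> ?S H" by blast
  qed
  then have "generate H (h ` ?S G) \<subseteq> generate H (?S H)" by (rule H.mono_generate)
  then show ?case using generate_img[OF sub] by (simp add: commutator_subgroup_def)
qed

lemma (in group_hom) nilpotent_group_if_inj_hom:
  assumes "nilpotent_group H" "inj_on h (carrier G)"
  shows "nilpotent_group G"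
proof -
  obtain n where n: "lower_central_series H n = {\<one>\<^bsub>H\<^esub>}"
    using assms(1) by (auto simp: nilpotent_group_def)
  have "x = \<one>" if x: "x \<in> lower_central_series G n" for x
  proof -
    have "x \<in> carrier G" using x G.lower_central_series_subset by blast
    moreover have "h x = h \<one>" using hom_lower_central_series[of n] n x by auto
    ultimately show ?thesis using inj_onD[OF assms(2)] G.one_closed by blast
  qed
  then have "lower_central_series G n = {\<one>}"
    using one_in_lower_central_series[OF G.is_group, of n] by blast
  then show ?thesis unfolding nilpotent_group_def using G.is_group by blast
qed

text \<open>
  The map sending \<open>x\<close> to the coset \<open>N #> x\<close> embeds a complement of \<open>N\<close> into the quotient by \<open>N\<close>.
\<close>

lemma (in group) complement_nilpotent:
  assumes N: "N \<lhd> G" and nil: "nilpotent_group (G Mod N)"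
    and K: "subgroup K G" "N \<inter> K = {\<one>}"
  shows "nilpotent_group (G\<lparr>carrier := K\<rparr>)"
proof -
  interpret N: normal N G by (rule N)
  interpret K: group "G\<lparr>carrier := K\<rparr>" using K(1) by (rule subgroup_imp_group)
  have KG: "K \<subseteq> carrier G" using K(1) by (rule subgroup.subset)
  interpret h: group_hom "G\<lparr>carrier := K\<rparr>" "G Mod N" "\<lambda>x. N #> x"
  proof (intro group_hom.intro group_hom_axioms.intro K.is_group N.factorgroup_is_group homI)
    fix x assume "x \<in> carrier (G\<lparr>carrier := K\<rparr>)"
    then show "N #> x \<in> carrier (G Mod N)" using KG by (auto simp: FactGroup_def RCOSETS_def)
  next
    fix x y assume "x \<in> carrier (G\<lparr>carrier := K\<rparr>)" "y \<in> carrier (G\<lparr>carrier := K\<rparr>)"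
    then show "N #> (x \<otimes>\<^bsub>G\<lparr>carrier := K\<rparr>\<^esub> y) = (N #> x) \<otimes>\<^bsub>G Mod N\<^esub> (N #> y)"
      using KG by (simp add: N.rcos_sum subset_iff)
  qed
  show ?thesis
  proof (rule h.nilpotent_group_if_inj_hom[OF nil], rule inj_onI)
    fix x y assume "x \<in> carrier (G\<lparr>carrier := K\<rparr>)" "y \<in> carrier (G\<lparr>carrier := K\<rparr>)"
      and eq: "N #> x = N #> y"
    then have xy: "x \<in> K" "y \<in> K" by simp_all
    have "x \<in> N #> y" using rcos_self[of x N] eq xy KG N.is_subgroup by auto
    then obtain n where n: "n \<in> N" "x = n \<otimes> y" by (auto simp: r_coset_def)
    have G: "x \<in> carrier G" "y \<in> carrier G" "n \<in> carrier G" using xy KG n(1) by auto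
    have "x \<otimes> inv y = n" using n(2) G by (simp add: m_assoc)
    moreover have "x \<otimes> inv y \<in> K" using xy K(1) by (simp add: subgroup.m_closed subgroup.m_inv_closed)
    ultimately have "n = \<one>" using n(1) K(2) by auto
    then show "x = y" using n(2) G by simp
  qed
qed

section \<open>Complements of a normal p-subgroup\<close>

lemma (in group) centralizer_subgroup:
  assumes "C \<subseteq> carrier G"
  shows "subgroup {x \<in> carrier G. \<forall>c\<in>C. x \<otimes> c = c \<otimes> x} G"
proof (rule subgroupI)
  show "{x \<in> carrier G. \<forall>c\<in>C. x \<otimes> c = c \<otimes> x} \<noteq> {}"
    using assms by (auto intro!: exI[of _ \<one>])
next
  fix a assume a: "a \<in> {x \<in> carrier G. \<forall>c\<in>C. x \<otimes> c = c \<otimes> x}"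
  have "inv a \<otimes> c = c \<otimes> inv a" if c: "c \<in> C" for c
  proof -
    have G: "a \<in> carrier G" "c \<in> carrier G" using a c assms by auto
    have "inv a \<otimes> c = inv a \<otimes> (c \<otimes> a) \<otimes> inv a" using G by (simp add: word_simps)
    also have "\<dots> = inv a \<otimes> (a \<otimes> c) \<otimes> inv a" using a c by simp
    also have "\<dots> = c \<otimes> inv a" using G by (simp add: word_simps)
    finally show ?thesis .
  qed
  then show "inv a \<in> {x \<in> carrier G. \<forall>c\<in>C. x \<otimes> c = c \<otimes> x}" using a by simp
next
  fix a b assume a: "a \<in> {x \<in> carrier G. \<forall>c\<in>C. x \<otimes> c = c \<otimes> x}"
    and b: "b \<in> {x \<in> carrier G. \<forall>c\<in>C. x \<otimes> c = c \<otimes> x}"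
  have "a \<otimes> b \<otimes> c = c \<otimes> (a \<otimes> b)" if c: "c \<in> C" for c
  proof -
    have G: "a \<in> carrier G" "b \<in> carrier G" "c \<in> carrier G" using a b c assms by auto
    have "a \<otimes> b \<otimes> c = a \<otimes> (c \<otimes> b)" using G b c by (simp add: m_assoc)
    also have "\<dots> = (a \<otimes> c) \<otimes> b" using G by (simp add: m_assoc)
    also have "\<dots> = c \<otimes> (a \<otimes> b)" using G a c by (simp add: m_assoc)
    finally show ?thesis .
  qed
  then show "a \<otimes> b \<in> {x \<in> carrier G. \<forall>c\<in>C. x \<otimes> c = c \<otimes> x}" using a b by simp
qed auto

text \<open>
  Two \<open>q\<close>-subgroups \<open>Q\<close> and \<open>R\<close> with the same image modulo a normal \<open>p\<close>-subgroup \<open>M\<close> are conjugate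
  by an element of \<open>M\<close>, and this element can be chosen to centralize whatever \<open>Q\<close> and \<open>R\<close>
  centralize. Indeed, both are Sylow \<open>q\<close>-subgroups of the centralizer \<open>H\<close> of \<open>C\<close> in \<open>M <#> Q\<close>, and
  \<open>H\<close> is the product of \<open>Q\<close> and the centralizer \<open>B\<close> of \<open>C\<close> in \<open>M\<close>; the factor in \<open>Q\<close> of the
  conjugating element normalizes \<open>Q\<close> and can be dropped. Leaving \<open>C\<close> fixed is what allows one prime to be treated after
  another in the next lemma.
\<close>

lemma (in group) conjugate_within_centralizer:
  assumes fin: "finite (carrier G)" and M: "M \<lhd> G" "card M = p ^ a"
    and pq: "Factorial_Ring.prime p" "Factorial_Ring.prime q" "p \<noteq> q"
    and Q: "subgroup Q G" "card Q = q ^ b"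
    and R: "subgroup R G" "card R = card Q" "R \<subseteq> M <#> Q"
    and C: "C \<subseteq> carrier G" "\<And>x c. x \<in> Q \<union> R \<Longrightarrow> c \<in> C \<Longrightarrow> x \<otimes> c = c \<otimes> x"
  shows "\<exists>m\<in>M. (\<forall>c\<in>C. m \<otimes> c = c \<otimes> m) \<and> (\<forall>x\<in>Q. m \<otimes> x \<otimes> inv m \<in> R)"
proof -
  define Z where "Z = {x \<in> carrier G. \<forall>c\<in>C. x \<otimes> c = c \<otimes> x}"
  define B where "B = M \<inter> Z"
  have Msub: "subgroup M G" using M(1) by (rule normal_imp_subgroup)
  have Z: "subgroup Z G" unfolding Z_def using C(1) by (rule centralizer_subgroup)
  have B: "subgroup B G" unfolding B_def using Msub Z by (rule subgroups_Inter_pair)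
  have MQ: "subgroup (M <#> Q) G" using M(1) Q(1) by (rule subgroup_set_mult_normal)
  define H where "H = (M <#> Q) \<inter> Z"
  have H: "subgroup H G" unfolding H_def using MQ Z by (rule subgroups_Inter_pair)
  have QZ: "Q \<subseteq> Z" "R \<subseteq> Z"
    using C(2) Q(1) R(1) subgroup.mem_carrier unfolding Z_def by (auto dest: subgroup.mem_carrier)
  have QH: "Q \<subseteq> H" "R \<subseteq> H"
    using QZ R(3) subset_set_mult(2)[OF Msub Q(1)] by (auto simp: H_def)
  have finsub: "finite S" if "subgroup S G" for S
    using subgroup.subset[OF that] fin by (rule finite_subset)
  have decomp: "\<exists>m\<in>B. \<exists>k\<in>Q. h = m \<otimes> k" if h: "h \<in> H" for h
  proof -
    obtain m k where mk: "m \<in> M" "k \<in> Q" "h = m \<otimes> k" using h by (auto simp: H_def set_mult_def)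
    have G: "m \<in> carrier G" "k \<in> carrier G"
      using mk Msub Q(1) by (auto dest: subgroup.mem_carrier)
    have "h \<otimes> inv k \<in> Z"
      using h mk(2) QZ Z by (auto simp: H_def intro!: subgroup.m_closed subgroup.m_inv_closed)
    then have "m \<in> B" using mk G by (simp add: B_def m_assoc)
    then show ?thesis using mk by blast
  qed
  have "B <#> Q = H"
  proof
    show "B <#> Q \<subseteq> H"
      using QZ subgroup.m_closed[OF Z] by (auto simp: B_def H_def set_mult_def)
    show "H \<subseteq> B <#> Q" using decomp by (auto simp: set_mult_def)
  qed
  have "card B dvd p ^ a"
    using card_subgroup_dvd[OF B Msub] finsub[OF Msub] M(2) by (simp add: B_def)
  then obtain i where i: "card B = p ^ i" using pq(1) divides_primepow_nat by blast
  then have "coprime (card B) (card Q)" using pq Q(2) by (simp add: primes_coprime)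
  then have "B \<inter> Q = {\<one>}" using inter_trivial_if_coprime_card B Q(1) finsub by blast
  then have cardH: "card H = card B * card R"
    using card_set_mult_trivial_inter[OF B Q(1)] \<open>B <#> Q = H\<close> R(2) by simp
  have "\<not> q dvd card B"
    using i pq by (metis prime_dvd_power primes_dvd_imp_eq)
  then obtain h where h: "h \<in> H" "\<forall>x\<in>Q. h \<otimes> x \<otimes> inv h \<in> R"
    using p_subgroup_conjugate_into_within[OF H finsub[OF H] pq(2) Q(1) QH(1) Q(2) R(1) QH(2) cardH]
    by blast
  obtain m k where mk: "m \<in> B" "k \<in> Q" "h = m \<otimes> k" using decomp[OF h(1)] by blast
  have G: "m \<in> carrier G" "k \<in> carrier G"
    using mk B Q(1) by (auto dest: subgroup.mem_carrier)
  have "m \<otimes> x \<otimes> inv m \<in> R" if x: "x \<in> Q" for x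
  proof -
    have xG: "x \<in> carrier G" using x Q(1) by (auto dest: subgroup.mem_carrier)
    have "inv k \<otimes> x \<otimes> k \<in> Q"
      using x mk(2) Q(1) by (simp add: subgroup.m_closed subgroup.m_inv_closed)
    then have "h \<otimes> (inv k \<otimes> x \<otimes> k) \<otimes> inv h \<in> R" using h(2) by blast
    then show ?thesis using mk(3) G xG by (simp add: word_simps)
  qed
  then show ?thesis using mk(1) unfolding B_def Z_def by blast
qed

text \<open>
  For complements of a normal \<open>p\<close>-subgroup \<open>M\<close>, the only obstruction to conjugacy sits at the
  prime \<open>p\<close>. The proof moves the Sylow subgroups of \<open>K\<close> into \<open>L\<close> one prime after another. Say that
  conjugation by \<open>m\<close> has moved those for the primes in \<open>\<pi>\<close>, and let \<open>C\<close> be their union. After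
  replacing \<open>L\<close> by its conjugate \<open>L'\<close> under \<open>inv m\<close>, the set \<open>C\<close> lies in both \<open>K\<close> and \<open>L'\<close>. For a
  new prime \<open>q\<close>, the Sylow subgroup \<open>Q\<close> of \<open>K\<close> and the corresponding subgroup
  \<open>R = L' \<inter> (M <#> Q)\<close> of \<open>L'\<close> both centralize \<open>C\<close>, so an element of \<open>M\<close> that centralizes \<open>C\<close>
  conjugates \<open>Q\<close> onto \<open>R\<close> without disturbing what has been achieved. Because \<open>K\<close> is
  nilpotent, this gives the Schur-Zassenhaus conjugacy for the primes other than \<open>p\<close> from Sylow's
  theorem alone.
\<close>

lemma (in group) p_kernel_complements_conjugate:
  assumes fin: "finite (carrier G)" and M: "M \<lhd> G" "card M = p ^ a"
    and p: "Factorial_Ring.prime p"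
    and K: "subgroup K G" "nilpotent_group (G\<lparr>carrier := K\<rparr>)" "M \<inter> K = {\<one>}"
    and L: "subgroup L G" "M \<inter> L = {\<one>}" "M <#> L = M <#> K"
    and base: "m0 \<in> M" "\<And>x. x \<in> p_part G K p \<Longrightarrow> m0 \<otimes> x \<otimes> inv m0 \<in> L"
  shows "\<exists>m\<in>M. \<forall>x\<in>K. m \<otimes> x \<otimes> inv m \<in> L"
proof -
  have Msub: "subgroup M G" using M(1) by (rule normal_imp_subgroup)
  note MG = subgroup.mem_carrier[OF Msub] and KG = subgroup.mem_carrier[OF K(1)]
    and LG = subgroup.mem_carrier[OF L(1)]
  have finsub: "finite S" if "subgroup S G" for S
    using subgroup.subset[OF that] fin by (rule finite_subset)
  have Mconj: "g \<otimes> m \<otimes> inv g \<in> M" if "g \<in> carrier G" "m \<in> M" for g m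
    using M(1) that by (auto simp: normal_inv_iff)
  note nilK = K(1) finsub[OF K(1)] K(2)
  have primes_step: "\<exists>m\<in>M. \<forall>q\<in>insert p \<pi>. \<forall>x\<in>p_part G K q. m \<otimes> x \<otimes> inv m \<in> L"
    if "finite \<pi>" "\<forall>q\<in>\<pi>. Factorial_Ring.prime q" for \<pi>
    using that
  proof (induction \<pi>)
    case empty
    then show ?case using base by auto
  next
    case (insert q \<pi>)
    then have "\<exists>m\<in>M. \<forall>r\<in>insert p \<pi>. \<forall>x\<in>p_part G K r. m \<otimes> x \<otimes> inv m \<in> L" by simp
    then obtain m where m: "m \<in> M"
      and m_conj: "\<And>r x. r \<in> insert p \<pi> \<Longrightarrow> x \<in> p_part G K r \<Longrightarrow> m \<otimes> x \<otimes> inv m \<in> L"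
      by meson
    have mG: "m \<in> carrier G" using m by (rule MG)
    show ?case
    proof (cases "q = p")
      case True
      then show ?thesis using m m_conj by auto
    next
      case False
      have q: "Factorial_Ring.prime q" using insert.prems by simp
      define Q where "Q = p_part G K q"
      define C where "C = (\<Union>r\<in>insert p \<pi>. p_part G K r)"
      define L' where "L' = (\<lambda>x. inv m \<otimes> x \<otimes> inv (inv m)) ` L"
      have L': "subgroup L' G" unfolding L'_def using L(1) inv_closed[OF mG] by (rule subgroup_conjugate_image)
      have L'_iff: "y \<in> L' \<longleftrightarrow> m \<otimes> y \<otimes> inv m \<in> L" if "y \<in> carrier G" for y
        unfolding L'_def using subgroup.subset[OF L(1)] mG that by (rule mem_inv_conjugate_image_iff)
      have Q: "subgroup Q G" "card Q = q ^ multiplicity q (card K)" "Q \<subseteq> K"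
        unfolding Q_def using nilpotent_p_part[OF nilK q] p_part_subset[of G K] by auto
      have QG: "x \<in> carrier G" if "x \<in> Q" for x using that Q(1) by (auto dest: subgroup.mem_carrier)
      have CK: "C \<subseteq> K" using p_part_subset[of G K] by (auto simp: C_def)
      then have CG: "C \<subseteq> carrier G" using KG by auto
      have CL': "c \<in> L'" if c: "c \<in> C" for c
      proof -
        have "m \<otimes> c \<otimes> inv m \<in> L" using c m_conj unfolding C_def by blast
        then show ?thesis using L'_iff c CG by blast
      qed
      define R where "R = L' \<inter> (M <#> Q)"
      have MQ: "subgroup (M <#> Q) G" using M(1) Q(1) by (rule subgroup_set_mult_normal)
      have R: "subgroup R G" unfolding R_def using L' MQ by (rule subgroups_Inter_pair)
      have M_meet_L': "x = \<one>" if x: "x \<in> M" "x \<in> L'" for x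
      proof -
        have "m \<otimes> x \<otimes> inv m \<in> M \<inter> L" using x L'_iff MG Mconj[OF mG] by auto
        then have "m \<otimes> x \<otimes> inv m = \<one>" using L(2) by auto
        then have "inv m \<otimes> (m \<otimes> x \<otimes> inv m) \<otimes> m = inv m \<otimes> \<one> \<otimes> m" by simp
        then show ?thesis using mG MG[OF x(1)] by (simp add: word_simps)
      qed
      have "M <#> L \<subseteq> M <#> L'"
      proof
        fix y assume "y \<in> M <#> L"
        then obtain n l where nl: "n \<in> M" "l \<in> L" "y = n \<otimes> l" by (auto simp: set_mult_def)
        define l' where "l' = inv m \<otimes> l \<otimes> inv (inv m)"
        have l': "l' \<in> L'" using nl(2) by (simp add: L'_def l'_def)
        have G: "n \<in> carrier G" "l \<in> carrier G" "l' \<in> carrier G"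
          using nl MG LG subgroup.mem_carrier[OF L' l'] by auto
        have "y = (n \<otimes> (m \<otimes> (l' \<otimes> inv m \<otimes> inv l'))) \<otimes> l'"
          using nl(3) G mG by (simp add: l'_def word_simps)
        moreover have "n \<otimes> (m \<otimes> (l' \<otimes> inv m \<otimes> inv l')) \<in> M"
          using nl(1) m Msub Mconj[OF G(3), of "inv m"]
          by (simp add: subgroup.m_closed subgroup.m_inv_closed)
        ultimately show "y \<in> M <#> L'" using l' unfolding set_mult_def by blast
      qed
      then have "M <#> Q \<subseteq> M <#> L'"
        using mono_set_mult[OF subset_refl Q(3), of G M] L(3) by auto
      then have "M <#> R = M <#> Q"
        unfolding R_def by (rule dedekind_modular_law[OF Msub L' MQ subset_set_mult(1)[OF Msub Q(1)]])
      moreover have "M \<inter> R = {\<one>}"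
        using M_meet_L' subgroup.one_closed[OF Msub] subgroup.one_closed[OF R] unfolding R_def by blast
      moreover have "M \<inter> Q = {\<one>}"
        using K(3) Q(3) subgroup.one_closed[OF Msub] subgroup.one_closed[OF Q(1)] by blast
      ultimately have "card M * card R = card M * card Q"
        using card_set_mult_trivial_inter[OF Msub] R Q(1) by metis
      then have cardR: "card R = card Q" using M(2) p prime_gt_0_nat by simp
      \<comment> \<open>Sylow subgroups of \<open>K\<close> for distinct primes commute, which settles \<open>Q\<close>. An element of \<open>R\<close>
        agrees with one of \<open>Q\<close> modulo \<open>M\<close>, so its commutator with \<open>c\<close> lies in \<open>M\<close>; as \<open>c\<close> is in
        \<open>L'\<close>, the commutator also lies in \<open>L'\<close>, which meets \<open>M\<close> trivially.\<close>
      have "x \<otimes> c = c \<otimes> x" if x: "x \<in> Q \<union> R" and c: "c \<in> C" for x c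
      proof -
        have cG: "c \<in> carrier G" using c CG by auto
        have kc: "k \<otimes> c = c \<otimes> k" if k: "k \<in> Q" for k
        proof -
          obtain r where r: "r \<in> insert p \<pi>" "c \<in> p_part G K r" using c by (auto simp: C_def)
          have "Factorial_Ring.prime r" "q \<noteq> r" using r(1) insert p False by auto
          then show ?thesis
            using nilpotent_p_parts_commute[OF nilK q _ _ _ r(2)] k by (simp add: Q_def)
        qed
        show ?thesis
        proof (cases "x \<in> Q")
          case True
          then show ?thesis by (rule kc)
        next
          case False
          then have xR: "x \<in> R" using x by simp
          then obtain n k where nk: "n \<in> M" "k \<in> Q" "x = n \<otimes> k"
            by (auto simp: R_def set_mult_def)
          have G: "n \<in> carrier G" "k \<in> carrier G" using nk MG QG by auto
          have xG: "x \<in> carrier G" using nk G by simp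
          have "x \<otimes> c \<otimes> inv x \<otimes> inv c = n \<otimes> (k \<otimes> c \<otimes> inv k) \<otimes> inv n \<otimes> inv c"
            using G cG nk(3) by (simp add: word_simps)
          also have "k \<otimes> c \<otimes> inv k = c" using kc[OF nk(2)] G cG by (simp add: m_assoc)
          also have "n \<otimes> c \<otimes> inv n \<otimes> inv c = n \<otimes> (c \<otimes> inv n \<otimes> inv c)"
            using G cG by (simp add: m_assoc)
          also have "\<dots> \<in> M" using Mconj[OF cG, of "inv n"] nk(1) Msub
            by (simp add: subgroup.m_closed subgroup.m_inv_closed)
          finally have "x \<otimes> c \<otimes> inv x \<otimes> inv c \<in> M" .
          moreover have "x \<otimes> c \<otimes> inv x \<otimes> inv c \<in> L'"
            using xR CL'[OF c] L' by (simp add: R_def subgroup.m_closed subgroup.m_inv_closed)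
          ultimately have "x \<otimes> c \<otimes> inv x \<otimes> inv c = \<one>" by (rule M_meet_L')
          then show ?thesis using xG cG by (rule commute_if_commutator_one[rotated 2])
        qed
      qed
      then obtain n where n: "n \<in> M" "\<forall>c\<in>C. n \<otimes> c = c \<otimes> n" "\<forall>x\<in>Q. n \<otimes> x \<otimes> inv n \<in> R"
        using conjugate_within_centralizer[OF fin M p q False[symmetric] Q(1,2) R cardR _ CG]
        by (auto simp: R_def)
      have nG: "n \<in> carrier G" using n(1) by (rule MG)
      have "(m \<otimes> n) \<otimes> x \<otimes> inv (m \<otimes> n) \<in> L"
        if r: "r \<in> insert p (insert q \<pi>)" and x: "x \<in> p_part G K r" for r x
      proof -
        have xG: "x \<in> carrier G" using x p_part_subset[of G K] KG by auto
        have eq: "(m \<otimes> n) \<otimes> x \<otimes> inv (m \<otimes> n) = m \<otimes> (n \<otimes> x \<otimes> inv n) \<otimes> inv m"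
          using mG nG xG by (simp add: word_simps)
        show ?thesis
        proof (cases "r = q")
          case True
          then have "n \<otimes> x \<otimes> inv n \<in> L'" using n(3) x by (auto simp: Q_def R_def)
          then show ?thesis using eq L'_iff xG nG by simp
        next
          case False
          then have xC: "x \<in> C" using r x by (auto simp: C_def)
          then have "n \<otimes> x \<otimes> inv n = x" using n(2) xG nG by (simp add: m_assoc)
          then show ?thesis using eq CL'[OF xC] L'_iff[OF xG] by simp
        qed
      qed
      then show ?thesis using subgroup.m_closed[OF Msub m n(1)] by blast
    qed
  qed
  have cardK: "card K > 0"
    using subgroup.one_closed[OF K(1)] finsub[OF K(1)] by (auto simp: card_gt_0_iff)
  obtain m where m: "m \<in> M"
      "\<And>q x. q \<in> insert p (prime_factors (card K)) \<Longrightarrow> x \<in> p_part G K q \<Longrightarrow> m \<otimes> x \<otimes> inv m \<in> L"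
    using primes_step[of "prime_factors (card K)"] by (metis finite_set_mset in_prime_factors_imp_prime)
  have mG: "m \<in> carrier G" using m(1) by (rule MG)
  define D where "D = K \<inter> (\<lambda>x. inv m \<otimes> x \<otimes> inv (inv m)) ` L"
  have D: "subgroup D G"
    unfolding D_def
    using K(1) subgroup_conjugate_image[OF L(1) inv_closed[OF mG]] by (rule subgroups_Inter_pair)
  have "D = K"
  proof (rule subgroup_containing_p_parts[OF nilK D])
    show "D \<subseteq> K" by (simp add: D_def)
    fix q :: nat assume q: "Factorial_Ring.prime q" "q dvd card K"
    show "p_part G K q \<subseteq> D"
    proof
      fix x assume x: "x \<in> p_part G K q"
      then have xK: "x \<in> K" using p_part_subset[of G K] by auto
      have "m \<otimes> x \<otimes> inv m \<in> L" using m(2)[OF _ x] q cardK by (simp add: in_prime_factors_iff)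
      then show "x \<in> D"
        unfolding D_def using xK mem_inv_conjugate_image_iff[OF subgroup.subset[OF L(1)] mG KG[OF xK]]
        by blast
    qed
  qed
  have "m \<otimes> x \<otimes> inv m \<in> L" if x: "x \<in> K" for x
    using x \<open>D = K\<close> mem_inv_conjugate_image_iff[OF subgroup.subset[OF L(1)] mG KG[OF x]]
    unfolding D_def by blast
  then show ?thesis using m(1) by blast
qed

section \<open>Reduction to one prime divisor of the kernel\<close>

text \<open>
  Think of two complements \<open>K\<close> and \<open>L\<close> of \<open>N = M \<times> A\<close>. Comparing them gives a crossed
  homomorphism from \<open>K\<close> to \<open>N\<close>, and its composition with the projection onto \<open>M\<close> belongs to a complement of \<open>M\<close> in \<open>M <#> K\<close>. That
  complement is \<open>(A <#> L) \<inter> (M <#> K)\<close>; it replaces the image of \<open>L\<close> in the quotient by \<open>A\<close>.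
\<close>

lemma (in group) complement_component:
  assumes M: "M \<lhd> G" and A: "A \<lhd> G" "M \<inter> A = {\<one>}"
    and L: "subgroup L G" "(M <#> A) <#> L = carrier G" "(M <#> A) \<inter> L = {\<one>}"
    and K: "subgroup K G"
  shows "subgroup ((A <#> L) \<inter> (M <#> K)) G"
    and "M \<inter> ((A <#> L) \<inter> (M <#> K)) = {\<one>}"
    and "M <#> ((A <#> L) \<inter> (M <#> K)) = M <#> K"
proof -
  let ?L0 = "(A <#> L) \<inter> (M <#> K)"
  have Msub: "subgroup M G" and Asub: "subgroup A G" using M A by (auto intro: normal_imp_subgroup)
  note MG = subgroup.mem_carrier[OF Msub] and AG = subgroup.mem_carrier[OF Asub]
    and LG = subgroup.mem_carrier[OF L(1)]
  have MK: "subgroup (M <#> K) G" using M K by (rule subgroup_set_mult_normal)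
  show sub: "subgroup ?L0 G"
    using subgroup_set_mult_normal[OF A(1) L(1)] MK by (rule subgroups_Inter_pair)
  have "x = \<one>" if x: "x \<in> M" "x \<in> A <#> L" for x
  proof -
    obtain a l where al: "a \<in> A" "l \<in> L" "x = a \<otimes> l" using x(2) by (auto simp: set_mult_def)
    have G: "a \<in> carrier G" "l \<in> carrier G" "x \<in> carrier G" using al AG LG MG x(1) by auto
    have "inv a \<otimes> x = l" using al(3) G by (simp add: word_simps)
    moreover have "A <#> M = M <#> A" using commut_normal[OF Msub A(1)] by simp
    moreover have "inv a \<otimes> x \<in> A <#> M"
      using al(1) x(1) Asub by (auto simp: set_mult_def intro: subgroup.m_inv_closed)
    ultimately have "l = \<one>" using al(2) L(3) by auto
    then have "x = a" using al(3) G by simp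
    then show "x = \<one>" using al(1) x(1) A(2) by auto
  qed
  then show "M \<inter> ?L0 = {\<one>}"
    using subgroup.one_closed[OF Msub] subgroup.one_closed[OF sub] by blast
  have "M <#> K \<subseteq> M <#> (A <#> L)"
    using L(2) set_mult_assoc[of M A L] subgroup.subset[OF MK] subgroup.subset[OF Msub]
      subgroup.subset[OF Asub] subgroup.subset[OF L(1)] by simp
  then show "M <#> ?L0 = M <#> K"
    by (rule dedekind_modular_law[OF Msub subgroup_set_mult_normal[OF A(1) L(1)] MK
        subset_set_mult(1)[OF Msub K]])
qed

text \<open>
  Transports a complement from one Sylow subgroup to another: the hypothesis of the theorem speaks of
  some Sylow subgroup \<open>S\<close>, whereas the complements at hand live in a conjugate \<open>S0\<close> of it.
\<close>

lemma (in group) complement_conjugate: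
  assumes N: "N \<lhd> G" and S0: "subgroup S0 G" and g: "g \<in> carrier G"
    and S: "subgroup S G" "S = (\<lambda>x. g \<otimes> x \<otimes> inv g) ` S0"
    and T: "subgroup T G" "T \<inter> N = {\<one>}" "(S0 \<inter> N) <#> T = S0"
  shows "is_complement (G\<lparr>carrier := S\<rparr>) (S \<inter> N) ((\<lambda>x. g \<otimes> x \<otimes> inv g) ` T)"
proof -
  let ?T = "(\<lambda>x. g \<otimes> x \<otimes> inv g) ` T"
  have Nsub: "subgroup N G" using N by (rule normal_imp_subgroup)
  note TG = subgroup.mem_carrier[OF T(1)] and S0G = subgroup.mem_carrier[OF S0]
  have T': "subgroup ?T G" using T(1) g by (rule subgroup_conjugate_image)
  have SN: "subgroup (S0 \<inter> N) G" using S0 Nsub by (rule subgroups_Inter_pair)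
  have TS0: "T \<subseteq> S0" using subset_set_mult(2)[OF SN T(1)] T(3) by simp
  then have T'S: "?T \<subseteq> S" using S(2) by auto
  have "(S \<inter> N) <#> ?T = S"
  proof
    show "(S \<inter> N) <#> ?T \<subseteq> S"
      using T'S subgroup.m_closed[OF S(1)] by (auto simp: set_mult_def)
    show "S \<subseteq> (S \<inter> N) <#> ?T"
    proof
      fix s assume "s \<in> S"
      then obtain y where y: "y \<in> S0" "s = g \<otimes> y \<otimes> inv g" using S(2) by auto
      then have "y \<in> (S0 \<inter> N) <#> T" using T(3) by simp
      then obtain n t where nt: "n \<in> S0" "n \<in> N" "t \<in> T" "y = n \<otimes> t"
        by (auto simp: set_mult_def)
      have "s = (g \<otimes> n \<otimes> inv g) \<otimes> (g \<otimes> t \<otimes> inv g)"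
        using y nt g S0G TG by (simp add: word_simps)
      moreover have "g \<otimes> n \<otimes> inv g \<in> S \<inter> N"
        using nt g N S(2) by (auto simp: normal_inv_iff)
      ultimately show "s \<in> (S \<inter> N) <#> ?T" using nt(3) by (auto simp: set_mult_def)
    qed
  qed
  moreover have "(S \<inter> N) \<inter> ?T = {\<one>}"
  proof -
    have "x = \<one>" if x: "x \<in> N" "x \<in> ?T" for x
    proof -
      obtain t where t: "t \<in> T" "x = g \<otimes> t \<otimes> inv g" using x(2) by auto
      have "inv g \<otimes> x \<otimes> inv (inv g) \<in> N" using x(1) g N by (meson inv_closed normal_inv_iff)
      then have "t \<in> N" using t g TG by (simp add: word_simps)
      then have "t = \<one>" using t(1) T(2) by auto
      then show ?thesis using t(2) g by simp
    qed
    then show ?thesis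
      using subgroup.one_closed[OF S(1)] subgroup.one_closed[OF Nsub] subgroup.one_closed[OF T'] by blast
  qed
  moreover have "subgroup ?T (G\<lparr>carrier := S\<rparr>)" using T' S(1) T'S by (rule subgroup_incl)
  ultimately show ?thesis by (simp add: is_complement_def)
qed

text \<open>
  Here the hypothesis on Sylow subgroups enters. With \<open>P\<close> the Sylow \<open>p\<close>-subgroup of \<open>K\<close>, the group
  \<open>S0 = M <#> P\<close> is a Sylow \<open>p\<close>-subgroup of the whole group, it meets \<open>N\<close> in \<open>M\<close>, and both \<open>P\<close> and
  \<open>L1 = L0 \<inter> S0\<close> are complements of \<open>M\<close> in it. So some element \<open>u\<close> of the whole group conjugates
  \<open>P\<close> to \<open>L1\<close>. Write \<open>u = m \<otimes> a \<otimes> k\<close> with factors in \<open>M\<close>, \<open>A\<close> and \<open>K\<close>. The factor \<open>k\<close>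
  normalizes \<open>P\<close>. For \<open>x\<close> in \<open>P\<close> the commutator of \<open>a\<close> and \<open>x\<close> lies in \<open>A\<close> and in \<open>S0\<close>, hence in
  \<open>A \<inter> M\<close>, so \<open>a\<close> centralizes \<open>P\<close>. Therefore \<open>m\<close> already conjugates \<open>P\<close> into \<open>L0\<close>.
\<close>

lemma (in group) sylow_parts_conjugate:
  assumes fin: "finite (carrier G)" and p: "Factorial_Ring.prime p"
    and N: "N \<lhd> G" "nilpotent_group (G\<lparr>carrier := N\<rparr>)"
    and M: "M = p_part G N p"
    and A: "A \<lhd> G" "M \<inter> A = {\<one>}" "M <#> A = N"
    and K: "subgroup K G" "nilpotent_group (G\<lparr>carrier := K\<rparr>)" "N <#> K = carrier G" "N \<inter> K = {\<one>}"
    and L0: "subgroup L0 G" "M \<inter> L0 = {\<one>}" "M <#> L0 = M <#> K"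
    and S: "sylow_subgroup p G S"
    and conj: "\<And>K L. is_complement (G\<lparr>carrier := S\<rparr>) (S \<inter> N) K \<Longrightarrow>
      is_complement (G\<lparr>carrier := S\<rparr>) (S \<inter> N) L \<Longrightarrow> conjugate_in G K L"
  shows "\<exists>m\<in>M. \<forall>x\<in>p_part G K p. m \<otimes> x \<otimes> inv m \<in> L0"
proof -
  have Nsub: "subgroup N G" using N(1) by (rule normal_imp_subgroup)
  have finsub: "finite T" if "subgroup T G" for T
    using subgroup.subset[OF that] fin by (rule finite_subset)
  have MN: "M \<lhd> G" unfolding M using N(1) finsub[OF Nsub] N(2) p by (rule normal_p_part)
  have Msub: "subgroup M G" and Asub: "subgroup A G" using MN A by (auto intro: normal_imp_subgroup)
  define P where "P = p_part G K p"
  have P: "subgroup P G" "card P = p ^ multiplicity p (card K)" "P \<subseteq> K"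
    unfolding P_def using nilpotent_p_part[OF K(1) finsub[OF K(1)] K(2) p] p_part_subset[of G K] by auto
  note MG = subgroup.mem_carrier[OF Msub] and AG = subgroup.mem_carrier[OF Asub]
    and KG = subgroup.mem_carrier[OF K(1)]
    and PG = subgroup.mem_carrier[OF P(1)]
  have MsubN: "M \<subseteq> N" unfolding M by (rule p_part_subset)
  have AsubN: "A \<subseteq> N" using subset_set_mult(2)[OF Msub Asub] A(3) by simp
  define S0 where "S0 = M <#> P"
  have S0: "subgroup S0 G" unfolding S0_def using MN P(1) by (rule subgroup_set_mult_normal)
  have MS0: "M \<subseteq> S0" and PS0: "P \<subseteq> S0" unfolding S0_def using subset_set_mult[OF Msub P(1)] by auto
  have MP: "M \<inter> P = {\<one>}"
    using MsubN P(3) K(4) subgroup.one_closed[OF Msub] subgroup.one_closed[OF P(1)] by auto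
  have S0N: "S0 \<inter> N = M"
  proof
    show "S0 \<inter> N \<subseteq> M"
    proof
      fix x assume x: "x \<in> S0 \<inter> N"
      then obtain m k where mk: "m \<in> M" "k \<in> P" "x = m \<otimes> k" by (auto simp: S0_def set_mult_def)
      have "inv m \<otimes> x = k" using mk MG PG by (simp add: word_simps)
      moreover have "inv m \<otimes> x \<in> N"
        using mk(1) x MsubN Nsub by (auto intro: subgroup.m_closed subgroup.m_inv_closed)
      ultimately have "k = \<one>" using mk(2) P(3) K(4) by auto
      then show "x \<in> M" using mk MG by simp
    qed
    show "M \<subseteq> S0 \<inter> N" using MS0 MsubN by simp
  qed
  define L1 where "L1 = L0 \<inter> S0"
  have L1: "subgroup L1 G" unfolding L1_def using L0(1) S0 by (rule subgroups_Inter_pair)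
  have "S0 \<subseteq> M <#> L0"
    using L0(3) mono_set_mult[OF subset_refl P(3)] by (auto simp: S0_def)
  then have M_mult_L1: "M <#> L1 = S0"
    unfolding L1_def by (rule dedekind_modular_law[OF Msub L0(1) S0 MS0])
  have NL1: "L1 \<inter> N = {\<one>}"
  proof -
    have "L1 \<inter> N \<subseteq> M \<inter> L0" using S0N by (auto simp: L1_def)
    then show ?thesis using L0(2) subgroup.one_closed[OF L1] subgroup.one_closed[OF Nsub] by blast
  qed
  have NP: "P \<inter> N = {\<one>}"
    using P(3) K(4) subgroup.one_closed[OF P(1)] subgroup.one_closed[OF Nsub] by auto
  have ord: "order G = card N * card K"
    using card_set_mult_trivial_inter[OF Nsub K(1,4)] K(3) by (simp add: order_def)
  have ord0: "order G \<noteq> 0" using fin by (simp add: order_gt_0_iff_finite)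
  have np: "\<not> is_unit p" using p by auto
  have Ssub: "subgroup S G" and cardS: "card S = p ^ multiplicity p (order G)"
    using S by (auto simp: sylow_subgroup_def)
  have "card S0 = p ^ multiplicity p (card N) * p ^ multiplicity p (card K)"
    using card_set_mult_trivial_inter[OF Msub P(1) MP] P(2)
      nilpotent_p_part(2)[OF Nsub finsub[OF Nsub] N(2) p] by (simp add: S0_def M)
  also have "\<dots> = p ^ multiplicity p (order G)"
    using ord ord0 p by (simp add: power_add prime_elem_multiplicity_mult_distrib)
  finally have cardS0: "card S0 = p ^ multiplicity p (order G)" .
  obtain c where c: "order G = p ^ multiplicity p (order G) * c" "\<not> p dvd c"
    using multiplicity_decompose'[OF ord0 np] by blast
  have "card (carrier G) = c * card S" using c(1) cardS by (simp add: order_def mult.commute)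
  then obtain g where g: "g \<in> carrier G" "\<forall>r\<in>S0. g \<otimes> r \<otimes> inv g \<in> S"
    using p_subgroup_conjugate_into_within[OF subgroup_self fin p S0 subgroup.subset[OF S0] cardS0
        Ssub subgroup.subset[OF Ssub] _ c(2)] by blast
  let ?c = "\<lambda>x. g \<otimes> x \<otimes> inv g"
  have Seq: "S = ?c ` S0"
    using g cardS cardS0 card_conjugate_image[OF subgroup.subset[OF S0] g(1)]
    by (intro card_subset_eq[symmetric] finsub[OF Ssub]) auto
  have "is_complement (G\<lparr>carrier := S\<rparr>) (S \<inter> N) (?c ` P)"
    by (rule complement_conjugate[OF N(1) S0 g(1) Ssub Seq P(1) NP]) (simp add: S0N S0_def[symmetric])
  moreover have "is_complement (G\<lparr>carrier := S\<rparr>) (S \<inter> N) (?c ` L1)"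
    by (rule complement_conjugate[OF N(1) S0 g(1) Ssub Seq L1 NL1]) (simp add: S0N M_mult_L1)
  ultimately have "conjugate_in G (?c ` P) (?c ` L1)" by (rule conj)
  moreover have "?c ` P \<subseteq> carrier G" using g(1) PG by auto
  ultimately obtain h where h: "h \<in> carrier G" "?c ` L1 = (\<lambda>x. h \<otimes> x \<otimes> inv h) ` ?c ` P"
    by (auto simp: conjugate_in_def conjugate_eq_image)
  \<comment> \<open>Conjugation by \<open>g\<close> identifies \<open>S0\<close> with \<open>S\<close>; undoing it turns \<open>h\<close> into \<open>u\<close>.\<close>
  define u where "u = inv g \<otimes> h \<otimes> g"
  have uG: "u \<in> carrier G" using g(1) h(1) by (simp add: u_def)
  have u: "u \<otimes> x \<otimes> inv u \<in> L1" if x: "x \<in> P" for x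
  proof -
    have "h \<otimes> ?c x \<otimes> inv h \<in> ?c ` L1" using h(2) x by blast
    then obtain y where y: "y \<in> L1" "h \<otimes> ?c x \<otimes> inv h = ?c y" by auto
    have yG: "y \<in> carrier G" using subgroup.mem_carrier[OF L1 y(1)] .
    have "u \<otimes> x \<otimes> inv u = inv g \<otimes> (h \<otimes> ?c x \<otimes> inv h) \<otimes> g"
      using g(1) h(1) PG[OF x] by (simp add: u_def word_simps)
    also have "\<dots> = y" using y(2) g(1) yG by (simp add: word_simps)
    finally show ?thesis using y(1) by simp
  qed
  have "u \<in> (M <#> A) <#> K" using uG K(3) A(3) by simp
  then obtain m a k where mak: "m \<in> M" "a \<in> A" "k \<in> K" "u = m \<otimes> a \<otimes> k"
    by (auto simp: set_mult_def)
  have G: "m \<in> carrier G" "a \<in> carrier G" "k \<in> carrier G" using mak MG AG KG by auto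
  have "m \<otimes> x \<otimes> inv m \<in> L0" if x: "x \<in> P" for x
  proof -
    have xG: "x \<in> carrier G" using x by (rule PG)
    have "inv k \<otimes> x \<otimes> inv (inv k) \<in> P"
      unfolding P_def
    proof (rule p_part_conjugate)
      show "x \<in> p_part G K p" using x by (simp add: P_def)
      show "inv k \<otimes> x \<otimes> inv (inv k) \<in> K"
        using x P(3) mak(3) K(1) by (auto intro!: subgroup.m_closed subgroup.m_inv_closed)
    qed (use G subgroup.subset[OF K(1)] in auto)
    then have "u \<otimes> (inv k \<otimes> x \<otimes> inv (inv k)) \<otimes> inv u \<in> L1" by (rule u)
    moreover have "u \<otimes> (inv k \<otimes> x \<otimes> inv (inv k)) \<otimes> inv u = m \<otimes> (a \<otimes> x \<otimes> inv a) \<otimes> inv m"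
      using mak(4) G xG by (simp add: word_simps)
    ultimately have L1m: "m \<otimes> (a \<otimes> x \<otimes> inv a) \<otimes> inv m \<in> L1" by simp
    then have "inv m \<otimes> (m \<otimes> (a \<otimes> x \<otimes> inv a) \<otimes> inv m) \<otimes> m \<otimes> inv x \<in> S0"
      using mak(1) x MS0 PS0 S0 by (auto simp: L1_def intro!: subgroup.m_closed subgroup.m_inv_closed)
    then have "a \<otimes> (x \<otimes> inv a \<otimes> inv x) \<in> S0" using G xG by (simp add: word_simps)
    moreover have "x \<otimes> inv a \<otimes> inv x \<in> A"
      using A(1) xG subgroup.m_inv_closed[OF Asub mak(2)] by (auto simp: normal_inv_iff)
    then have inA: "a \<otimes> (x \<otimes> inv a \<otimes> inv x) \<in> A" using mak(2) Asub by (simp add: subgroup.m_closed)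
    ultimately have "a \<otimes> (x \<otimes> inv a \<otimes> inv x) \<in> M" using AsubN S0N by auto
    then have "a \<otimes> (x \<otimes> inv a \<otimes> inv x) = \<one>" using inA A(2) by auto
    then have "a \<otimes> x = x \<otimes> a" using G xG by (intro commute_if_commutator_one) (simp_all add: m_assoc)
    then have "a \<otimes> x \<otimes> inv a = x" using G xG by (simp add: m_assoc)
    then show ?thesis using L1m by (simp add: L1_def)
  qed
  then show ?thesis using mak(1) by (auto simp: P_def)
qed

lemma (in group) complement_conjugate_self:
  assumes N: "N \<lhd> G" and K: "is_complement G N K" and g: "g \<in> carrier G"
  shows "is_complement G N ((\<lambda>x. g \<otimes> x \<otimes> inv g) ` K)"
proof -
  have "carrier G = (\<lambda>x. g \<otimes> x \<otimes> inv g) ` carrier G"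
  proof
    show "carrier G \<subseteq> (\<lambda>x. g \<otimes> x \<otimes> inv g) ` carrier G"
    proof
      fix x assume "x \<in> carrier G"
      then have "x = g \<otimes> (inv g \<otimes> x \<otimes> g) \<otimes> inv g" "inv g \<otimes> x \<otimes> g \<in> carrier G"
        using g by (simp_all add: word_simps)
      then show "x \<in> (\<lambda>x. g \<otimes> x \<otimes> inv g) ` carrier G" by (rule image_eqI)
    qed
  qed (use g in auto)
  moreover have "carrier G \<inter> N = N" using subgroup.subset[OF normal_imp_subgroup[OF N]] by auto
  ultimately show ?thesis
    using complement_conjugate[OF N subgroup_self g subgroup_self, of K] K
    by (simp add: is_complement_def Int_commute)
qed

section \<open>Conjugacy of complements\<close>

theorem proposition3:
  fixes G (structure) and N :: "'a set"
  assumes "group G" and "finite (carrier G)"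
    and "N \<lhd> G" and "nilpotent_group (G\<lparr>carrier := N\<rparr>)"
    and "\<exists>K. is_complement G N K"
    and "nilpotent_group (G Mod N)"
    and "\<And>p :: nat. Factorial_Ring.prime p \<Longrightarrow>
           \<exists>S. sylow_subgroup p G S \<and>
             (\<forall>K L. is_complement (G\<lparr>carrier := S\<rparr>) (S \<inter> N) K \<longrightarrow>
                    is_complement (G\<lparr>carrier := S\<rparr>) (S \<inter> N) L \<longrightarrow> conjugate_in G K L)"
  shows "\<forall>K L. is_complement G N K \<longrightarrow> is_complement G N L \<longrightarrow> conjugate_in G K L"
proof (intro allI impI)
  fix K L assume K: "is_complement G N K" and L: "is_complement G N L"
  interpret group G by fact
  note fin = assms(2) and N = assms(3)
  have Nsub: "subgroup N G" using N by (rule normal_imp_subgroup)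
  have finN: "finite N" using subgroup.subset[OF Nsub] fin by (rule finite_subset)
  have Lsub: "subgroup L G" and NL: "N \<inter> L = {\<one>}" "N <#> L = carrier G"
    using L by (auto simp: is_complement_def)
  define hall where "hall p B \<longleftrightarrow> B \<lhd> G \<and> B \<subseteq> N \<and>
      (\<forall>q. Factorial_Ring.prime q \<longrightarrow> q \<noteq> p \<longrightarrow> p_part G N q \<subseteq> B) \<and>
      \<not> p dvd card B \<and> p_part G N p \<inter> B = {\<one>} \<and> p_part G N p <#> B = N" for p B
  have "\<exists>B. hall p B" if p: "Factorial_Ring.prime p" for p
    by (rule nilpotent_p_complement[OF N finN assms(4) p]) (auto simp: hall_def)
  then obtain A where hall: "\<And>p. Factorial_Ring.prime p \<Longrightarrow> hall p (A p)" by metis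
  have A: "A p \<lhd> G" "A p \<subseteq> N" "\<And>q. Factorial_Ring.prime q \<Longrightarrow> q \<noteq> p \<Longrightarrow> p_part G N q \<subseteq> A p"
      "\<not> p dvd card (A p)" "p_part G N p \<inter> A p = {\<one>}" "p_part G N p <#> A p = N"
    if "Factorial_Ring.prime p" for p
    using hall[OF that] unfolding hall_def by blast+
  have AL: "subgroup (A p <#> L) G" "A p \<subseteq> A p <#> L" if p: "Factorial_Ring.prime p" for p
    using subgroup_set_mult_normal[OF A(1)[OF p] Lsub]
      subset_set_mult(1)[OF normal_imp_subgroup[OF A(1)[OF p]] Lsub] by auto
  \<comment> \<open>Modulo \<open>A p\<close> every complement can be moved into \<open>L\<close> by an element of the \<open>p\<close>-part of \<open>N\<close>.\<close>
  have one_prime: "\<exists>m\<in>p_part G N p. \<forall>x\<in>J. m \<otimes> x \<otimes> inv m \<in> A p <#> L"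
    if p: "Factorial_Ring.prime p" and J: "is_complement G N J" for p J
  proof -
    define M where "M = p_part G N p"
    define L0 where "L0 = (A p <#> L) \<inter> (M <#> J)"
    have M: "M \<lhd> G" "card M = p ^ multiplicity p (card N)"
      unfolding M_def using normal_p_part[OF N finN assms(4) p]
        nilpotent_p_part(2)[OF Nsub finN assms(4) p] by auto
    have Jsub: "subgroup J G" and NJ: "N <#> J = carrier G" "N \<inter> J = {\<one>}"
      using J by (auto simp: is_complement_def)
    have nilJ: "nilpotent_group (G\<lparr>carrier := J\<rparr>)"
      using complement_nilpotent[OF N assms(6) Jsub NJ(2)] .
    have MA: "M \<inter> A p = {\<one>}" "M <#> A p = N" using A(5,6)[OF p] by (auto simp: M_def)
    have L0: "subgroup L0 G" "M \<inter> L0 = {\<one>}" "M <#> L0 = M <#> J"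
      unfolding L0_def using complement_component[OF M(1) A(1)[OF p] MA(1) Lsub _ _ Jsub] NL MA(2)
      by simp_all
    obtain S where S: "sylow_subgroup p G S"
      "\<And>K L. is_complement (G\<lparr>carrier := S\<rparr>) (S \<inter> N) K \<Longrightarrow>
        is_complement (G\<lparr>carrier := S\<rparr>) (S \<inter> N) L \<Longrightarrow> conjugate_in G K L"
      using assms(7)[OF p] by blast
    obtain m0 where m0: "m0 \<in> M" "\<And>x. x \<in> p_part G J p \<Longrightarrow> m0 \<otimes> x \<otimes> inv m0 \<in> L0"
      using sylow_parts_conjugate[OF fin p N assms(4) M_def A(1)[OF p] MA Jsub nilJ NJ L0 S] by blast
    have "M \<inter> J = {\<one>}"
      using NJ(2) p_part_subset[of G N p] subgroup.one_closed[OF Jsub]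
        subgroup.one_closed[OF normal_imp_subgroup[OF M(1)]] by (auto simp: M_def)
    then obtain m where "m \<in> M" "\<forall>x\<in>J. m \<otimes> x \<otimes> inv m \<in> L0"
      using p_kernel_complements_conjugate[OF fin M p Jsub nilJ _ L0 m0] by blast
    then show ?thesis by (auto simp: M_def L0_def)
  qed
  \<comment> \<open>The correction \<open>m\<close> for a new prime \<open>q\<close> lies in the \<open>q\<close>-part of \<open>N\<close>, so in \<open>A p\<close> for every
    \<open>p \<noteq> q\<close>; it therefore does not spoil the containments already obtained.\<close>
  have primes_step: "\<exists>g\<in>N. \<forall>p\<in>\<pi>. \<forall>x\<in>K. g \<otimes> x \<otimes> inv g \<in> A p <#> L"
    if "finite \<pi>" "\<forall>p\<in>\<pi>. Factorial_Ring.prime p" for \<pi>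
    using that
  proof (induction \<pi>)
    case empty
    then show ?case using subgroup.one_closed[OF Nsub] by auto
  next
    case (insert q \<pi>)
    then have "\<exists>g\<in>N. \<forall>p\<in>\<pi>. \<forall>x\<in>K. g \<otimes> x \<otimes> inv g \<in> A p <#> L" by simp
    then obtain g where g: "g \<in> N" "\<And>p x. p \<in> \<pi> \<Longrightarrow> x \<in> K \<Longrightarrow> g \<otimes> x \<otimes> inv g \<in> A p <#> L"
      by meson
    have gG: "g \<in> carrier G" using g(1) Nsub by (auto dest: subgroup.mem_carrier)
    have q: "Factorial_Ring.prime q" using insert.prems by simp
    obtain m where m: "m \<in> p_part G N q"
      "\<And>x. x \<in> K \<Longrightarrow> m \<otimes> (g \<otimes> x \<otimes> inv g) \<otimes> inv m \<in> A q <#> L"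
      using one_prime[OF q complement_conjugate_self[OF N K gG]] by auto
    have mN: "m \<in> N" using m(1) p_part_subset[of G N q] by auto
    then have mG: "m \<in> carrier G" using Nsub by (auto dest: subgroup.mem_carrier)
    have "(m \<otimes> g) \<otimes> x \<otimes> inv (m \<otimes> g) \<in> A p <#> L" if p: "p \<in> insert q \<pi>" and x: "x \<in> K" for p x
    proof -
      have "x \<in> carrier G" using x K by (auto simp: is_complement_def dest: subgroup.mem_carrier)
      then have eq: "(m \<otimes> g) \<otimes> x \<otimes> inv (m \<otimes> g) = m \<otimes> (g \<otimes> x \<otimes> inv g) \<otimes> inv m"
        using mG gG by (simp add: word_simps)
      show ?thesis
      proof (cases "p = q")
        case True
        then show ?thesis using eq m(2)[OF x] by simp
      next
        case False
        then have p': "p \<in> \<pi>" "Factorial_Ring.prime p" using p insert.prems by auto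
        have "m \<in> A p <#> L" using A(3)[OF p'(2) q] False m(1) AL(2)[OF p'(2)] by auto
        then show ?thesis
          unfolding eq using g(2)[OF p'(1) x] AL(1)[OF p'(2)]
          by (simp add: subgroup.m_closed subgroup.m_inv_closed)
      qed
    qed
    then show ?case using subgroup.m_closed[OF Nsub mN g(1)] by blast
  qed
  have cardN: "card N > 0" using subgroup.one_closed[OF Nsub] finN by (auto simp: card_gt_0_iff)
  obtain g where g: "g \<in> N"
      "\<And>p x. p \<in> prime_factors (card N) \<Longrightarrow> x \<in> K \<Longrightarrow> g \<otimes> x \<otimes> inv g \<in> A p <#> L"
    using primes_step[of "prime_factors (card N)"] by (auto simp: in_prime_factors_iff)
  have gG: "g \<in> carrier G" using g(1) Nsub by (auto dest: subgroup.mem_carrier)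
  have KG: "K \<subseteq> carrier G" using K subgroup.subset by (auto simp: is_complement_def)
  \<comment> \<open>The component \<open>n\<close> in \<open>N\<close> of a conjugated element is determined by it, so it lies in
    \<open>A p\<close> for each prime \<open>p\<close> dividing the order of \<open>N\<close>; these subgroups have trivial
    intersection.\<close>
  have sub: "g \<otimes> x \<otimes> inv g \<in> L" if x: "x \<in> K" for x
  proof -
    have "g \<otimes> x \<otimes> inv g \<in> N <#> L" using NL(2) gG x KG by auto
    then obtain n l where nl: "n \<in> N" "l \<in> L" "g \<otimes> x \<otimes> inv g = n \<otimes> l"
      by (auto simp: set_mult_def)
    have G: "n \<in> carrier G" "l \<in> carrier G"
      using nl Nsub Lsub by (auto dest: subgroup.mem_carrier)
    have cyc: "subgroup (generate G {n}) G" "card (generate G {n}) = ord n"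
      using G(1) generate_pow_card[OF G(1)] by (auto intro: generate_is_subgroup)
    have dvd: "ord n dvd card H" if "subgroup H G" "n \<in> H" "finite H" for H
      using card_subgroup_dvd[OF cyc(1) that(1) generate_subgroup_incl[OF _ that(1)] that(3)]
        that(2) cyc(2) by simp
    have "\<not> p dvd ord n" if p: "Factorial_Ring.prime p" for p
    proof
      assume p_dvd: "p dvd ord n"
      have "p dvd card N" using p_dvd dvd[OF Nsub nl(1) finN] by (rule dvd_trans)
      then have "g \<otimes> x \<otimes> inv g \<in> A p <#> L" using g(2) x p cardN by (simp add: in_prime_factors_iff)
      then obtain a l' where al: "a \<in> A p" "l' \<in> L" "n \<otimes> l = a \<otimes> l'"
        using nl(3) by (auto simp: set_mult_def)
      have aN: "a \<in> N" using al(1) A(2)[OF p] by auto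
      have G': "a \<in> carrier G" "l' \<in> carrier G"
        using aN al Nsub Lsub by (auto dest: subgroup.mem_carrier)
      have "inv a \<otimes> (n \<otimes> l) \<otimes> inv l = inv a \<otimes> (a \<otimes> l') \<otimes> inv l" using al(3) by simp
      then have eq: "inv a \<otimes> n = l' \<otimes> inv l" using G G' by (simp add: word_simps)
      have "inv a \<otimes> n \<in> N" using aN nl(1) Nsub by (simp add: subgroup.m_closed subgroup.m_inv_closed)
      moreover have "inv a \<otimes> n \<in> L"
        unfolding eq using al(2) nl(2) Lsub by (simp add: subgroup.m_closed subgroup.m_inv_closed)
      ultimately have "inv a \<otimes> n = \<one>" using NL(1) by auto
      then have "n = a" using G G' by (metis inv_cancel_left(2) r_one)
      then have "ord n dvd card (A p)"
        using dvd[OF normal_imp_subgroup[OF A(1)[OF p]]] al(1) finite_subset[OF A(2)[OF p] finN] by simp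
      then show False using p_dvd A(4)[OF p] dvd_trans by blast
    qed
    then have "ord n = 1" using prime_factor_nat by blast
    then have "n = \<one>" using pow_eq_id[OF G(1), of 1] G(1) by simp
    then show ?thesis using nl G by simp
  qed
  have "card (carrier G) = card N * card K" "card (carrier G) = card N * card L"
    using card_set_mult_trivial_inter[OF Nsub, of K] card_set_mult_trivial_inter[OF Nsub, of L] K L
    by (simp_all add: is_complement_def)
  then have "card K = card L" using cardN by simp
  moreover have "finite L" using subgroup.subset[OF Lsub] fin by (rule finite_subset)
  ultimately have "(\<lambda>x. g \<otimes> x \<otimes> inv g) ` K = L"
    using sub card_conjugate_image[OF KG gG] by (intro card_subset_eq) auto
  then show "conjugate_in G K L"
    unfolding conjugate_in_def using conjugate_eq_image[OF KG gG] by (intro bexI[OF _ gG]) simp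
qed

end
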